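(* Fix $\kappa>0$. Let $p\in H^1_s(\mathbb{S}^1)$ be any (weak, probability density) solution of the stationary McKean-Vlasov equation $\partial_{\theta\theta}p=\kappa\,\partial_\theta\big(p\,\partial_\theta(W\star p)\big)$, and write $$p(\theta)=2\sum_{\ell=0}^\infty p_\ell\cos \ell\theta,\qquad \theta\in[0,2\pi).$$ Then $p_0=1/2$ and, for every $\ell\ge 1$, $$\ell(2-\kappa a_\ell)p_\ell=\kappa\sum_{1\le j<\ell} j a_j\,p_j\,p_{\ell-j}+\kappa\sum_{j>\ell}\big(ja_j-(j-\ell)a_{j-\ell}\big)p_j\,p_{j-\ell}.$$ Conversely, any $p\in H^1_s(\mathbb{S}^1)$, written as $p(\theta)=2\sum_{\ell=0}^\infty p_\ell\cos \ell\theta$, whose Fourier coefficients satisfy $p_0=1/2$ and $$\ell(2-\kappa a_\ell)p_\ell=\kappa\sum_{1\le j<\ell} j a_j\,p_j\,p_{\ell-j}+\kappa\sum_{j>\ell}\big(ja_j-(j-\ell)a_{j-\ell}\big)p_j\,p_{j-\ell}\qquad\text{for all }\ell\ge1$$ is a solution of the stationary McKean-Vlasov equation $\partial_{\theta\theta}p=\kappa\,\partial_\theta\big(p\,\partial_\theta(W\star p)\big)$. Moreover, any such solution satisfies the fixed point equation $$p(\theta)=\frac1Z\exp\Big(\kappa\sum_{\ell=1}^\infty p_\ell a_\ell\cos \ell\theta\Big),\quad \theta\in\mathbb{S}^1,\qquad Z=\frac{1}{2\pi}\int_0^{2\pi}\exp\Big(\kappa\sum_{\ell=1}^\infty p_\ell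 a_\ell\cos \ell\psi\Big)\,d\psi .$$
   Context: $\mathbb{S}^1=[0,2\pi)$ is the circle. The interaction potential $W:\mathbb{S}^1\to\mathbb{R}$ is even, square integrable, with Fourier expansion $W(\theta)=\sum_{\ell=1}^\infty a_\ell\cos \ell\theta$ ($a_\ell\in\mathbb{R}$). Convolution is normalized: $(W\star p)(\theta)=\frac1{2\pi}\int_0^{2\pi}W(\theta-\phi)p(\phi)\,d\phi$. Solutions are required to be probability densities with respect to $d\theta/2\pi$: $p\ge0$ and $\frac1{2\pi}\int_0^{2\pi}p(\theta)\,d\theta=1$. $H^1_s(\mathbb{S}^1)$ is the space of even functions on the circle that are square integrable and have a square integrable weak derivative. The equation is understood in the weak sense. *)

theory Defs
  imports "HOL-Analysis.Analysis" "HOL-Library.Periodic_Fun"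
begin

text \<open>
  Functions on the circle are \<open>2\<pi>\<close>-periodic functions on the reals, and integrals
  over the circle are Lebesgue integrals over one period. Elements of \<open>L\<^sup>2\<close> and of the
  Sobolev space are represented by functions that are periodic (and, where required, even) at every
  point; every periodic (even) class has such a representative.
\<close>

abbreviation circle_measure :: "real measure" where
  "circle_measure \<equiv> lebesgue_on {0..2 * pi}"

definition circle_L2 :: "(real \<Rightarrow> real) set" where
  "circle_L2 = {f. periodic_fun_simple f (2 * pi) \<and> f \<in> borel_measurable lebesgue \<and>
                   integrable circle_measure (\<lambda>\<theta>. (f \<theta>)\<^sup>2)}"

definition even_fun :: "(real \<Rightarrow> real) \<Rightarrow> bool" where
  "even_fun f \<longleftrightarrow> (\<forall>\<theta>. f (- \<theta>) = f \<theta>)"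

text \<open>Smooth functions on the circle, with derivatives of all orders on the whole line.\<close>

definition circle_test :: "(real \<Rightarrow> real) set" where
  "circle_test = {\<phi>. periodic_fun_simple \<phi> (2 * pi) \<and>
                     (\<forall>n \<theta>. (deriv ^^ n) \<phi> field_differentiable (at \<theta>))}"

definition weak_deriv :: "(real \<Rightarrow> real) \<Rightarrow> (real \<Rightarrow> real) \<Rightarrow> bool" where
  "weak_deriv f g \<longleftrightarrow>
     (\<forall>\<phi>\<in>circle_test. (\<integral>\<theta>. f \<theta> * deriv \<phi> \<theta> \<partial>circle_measure) =
                       - (\<integral>\<theta>. g \<theta> * \<phi> \<theta> \<partial>circle_measure))"

definition H1_s :: "(real \<Rightarrow> real) set" where
  "H1_s = {f. f \<in> circle_L2 \<and> even_fun f \<and> (\<exists>g\<in>circle_L2. weak_deriv f g)}"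

definition circle_conv :: "(real \<Rightarrow> real) \<Rightarrow> (real \<Rightarrow> real) \<Rightarrow> real \<Rightarrow> real" where
  "circle_conv W p \<theta> = 1 / (2 * pi) * (\<integral>\<phi>. W (\<theta> - \<phi>) * p \<phi> \<partial>circle_measure)"

text \<open>The function \<open>f\<close> is the sum, in \<open>L\<^sup>2\<close> of the circle, of the series of the functions
  \<open>u l\<close> with \<open>l \<ge> m\<close>.\<close>

definition L2_sums_from :: "nat \<Rightarrow> (nat \<Rightarrow> real \<Rightarrow> real) \<Rightarrow> (real \<Rightarrow> real) \<Rightarrow> bool" where
  "L2_sums_from m u f \<longleftrightarrow>
     (\<lambda>N. \<integral>\<theta>. (f \<theta> - (\<Sum>l = m..N. u l \<theta>))\<^sup>2 \<partial>circle_measure) \<longlonglongrightarrow> 0"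

definition circle_density :: "(real \<Rightarrow> real) \<Rightarrow> bool" where
  "circle_density p \<longleftrightarrow>
     (AE \<theta> in circle_measure. 0 \<le> p \<theta>) \<and> 1 / (2 * pi) * (\<integral>\<theta>. p \<theta> \<partial>circle_measure) = 1"

text \<open>
  The stationary equation \<open>p'' = \<kappa> (p (W \<star> p)')'\<close> tested against smooth \<open>\<phi>\<close>, with
  one derivative moved onto \<open>\<phi>\<close> on each side. Here \<open>g\<close> and \<open>v\<close> are the weak derivatives of
  \<open>p\<close> and \<open>W \<star> p\<close>; they are unique up to null sets, so the existential quantifier
  is equivalent to a universal one.
\<close>

definition weak_stationary_MV ::
    "real \<Rightarrow> (real \<Rightarrow> real) \<Rightarrow> (real \<Rightarrow> real) \<Rightarrow> bool" where
  "weak_stationary_MV \<kappa> W p \<longleftrightarrow>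
     (\<exists>g\<in>circle_L2. \<exists>v\<in>circle_L2.
        weak_deriv p g \<and> weak_deriv (circle_conv W p) v \<and>
        (\<forall>\<phi>\<in>circle_test.
           (\<integral>\<theta>. g \<theta> * deriv \<phi> \<theta> \<partial>circle_measure) =
           \<kappa> * (\<integral>\<theta>. p \<theta> * v \<theta> * deriv \<phi> \<theta> \<partial>circle_measure)))"

definition stationary_MV_solution ::
    "real \<Rightarrow> (real \<Rightarrow> real) \<Rightarrow> (real \<Rightarrow> real) \<Rightarrow> bool" where
  "stationary_MV_solution \<kappa> W p \<longleftrightarrow>
     p \<in> H1_s \<and> circle_density p \<and> weak_stationary_MV \<kappa> W p"

text \<open>The terms of the infinite series on the right-hand side of the coefficient equations.
  Here \<open>j > l\<close>, so the subtractions on the naturals do not truncate.\<close>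

definition coeff_tail :: "(nat \<Rightarrow> real) \<Rightarrow> (nat \<Rightarrow> real) \<Rightarrow> nat \<Rightarrow> nat \<Rightarrow> real" where
  "coeff_tail a c l j = (real j * a j - real (j - l) * a (j - l)) * c j * c (j - l)"

definition coeff_equation :: "real \<Rightarrow> (nat \<Rightarrow> real) \<Rightarrow> (nat \<Rightarrow> real) \<Rightarrow> nat \<Rightarrow> bool" where
  "coeff_equation \<kappa> a c l \<longleftrightarrow>
     real l * (2 - \<kappa> * a l) * c l =
       \<kappa> * (\<Sum>j = 1..<l. real j * a j * c j * c (l - j)) +
       \<kappa> * (\<Sum>\<^sub>\<infinity>j\<in>{l<..}. coeff_tail a c l j)"

definition gibbs_weight :: "real \<Rightarrow> (nat \<Rightarrow> real) \<Rightarrow> (nat \<Rightarrow> real) \<Rightarrow> real \<Rightarrow> real" where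
  "gibbs_weight \<kappa> a c \<theta> = exp (\<kappa> * (\<Sum>\<^sub>\<infinity>l\<in>{1..}. c l * a l * cos (real l * \<theta>)))"

definition gibbs_Z :: "real \<Rightarrow> (nat \<Rightarrow> real) \<Rightarrow> (nat \<Rightarrow> real) \<Rightarrow> real" where
  "gibbs_Z \<kappa> a c = 1 / (2 * pi) * (\<integral>\<psi>. gibbs_weight \<kappa> a c \<psi> \<partial>circle_measure)"

end

theory Submission
  imports Defs
begin

text \<open>
  Write \<open>V = W \<star> p\<close>. Integrated once, the stationary equation says \<open>p' = \<kappa> p V'\<close>: the constant of
  integration vanishes because \<open>p\<close> and \<open>V\<close> are even. Both sides are odd, so this equation is
  equivalent to equality of the sine coefficients, that is, to the stationary equation tested with the
  functions \<open>cos l\<theta>\<close>.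

  The weak derivative of \<open>p\<close> is square integrable, so by the Bessel inequality \<open>l c\<^sub>l\<close> is square
  summable. Hence the cosine series of \<open>p\<close> converges absolutely, and \<open>p\<close> agrees almost everywhere
  with its continuous sum \<open>P\<close>. The coefficients of \<open>V\<close> are \<open>a\<^sub>l c\<^sub>l\<close>, and \<open>l a\<^sub>l c\<^sub>l\<close> is
  absolutely summable as a product of two square summable sequences, so \<open>V\<close> is continuously
  differentiable. Multiplying the series of \<open>p\<close> and \<open>V'\<close> and collecting the frequency \<open>l\<close> gives
  \<open>product_sin_coeff\<close>, and comparison with the coefficient \<open>- l c\<^sub>l\<close> of \<open>p'\<close> gives
  \<open>coeff_equation_iff\<close>: the \<open>l\<close>-th coefficient equation is the equation tested with \<open>cos l\<theta>\<close>. This yields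
  the coefficient equations for every solution.

  Conversely, the coefficient equations say that \<open>P\<close> and an antiderivative of the continuous function
  \<open>\<kappa> P V'\<close> have the same cosine coefficients with index at least 1. Both are even and periodic,
  and the cosines are complete among the even functions (\<open>even_orthogonal_cos_imp_zero\<close>, a consequence of the
  Weierstrass theorem), so they differ by a constant and \<open>P' = \<kappa> P V'\<close> holds classically
  (\<open>P_deriv\<close>). This linear equation has the solution \<open>P = C exp (\<kappa> V)\<close>, where the mass
  of \<open>p\<close> fixes \<open>C = 1 / Z > 0\<close>. The exponential formula shows that \<open>p \<ge> 0\<close>, the differential equation gives
  the weak stationary equation, and together with the first part the formula holds for every solution.
\<close>

section \<open>Integration over the circle\<close>

lemma circle_L2_D:
  assumes "f \<in> circle_L2"
  shows "f \<in> borel_measurable circle_measure"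
    and "integrable circle_measure (\<lambda>x. (f x)\<^sup>2)"
    and "f (x + 2 * pi) = f x"
  using assms unfolding circle_L2_def periodic_fun_simple_def
  by (auto intro: measurable_restrict_space1)

lemma integrable_circle_continuous:
  fixes f :: "real \<Rightarrow> real"
  assumes "continuous_on UNIV f"
  shows "integrable circle_measure f"
  by (intro continuous_imp_integrable_real continuous_on_subset[OF assms]) auto

lemma circle_L2_continuous:
  assumes "continuous_on UNIV f" "\<And>x. f (x + 2 * pi) = f x"
  shows "f \<in> circle_L2"
proof -
  have "f \<in> borel_measurable lebesgue"
    using assms(1) continuous_imp_measurable_on_sets_lebesgue[of UNIV f] by simp
  moreover have "integrable circle_measure (\<lambda>x. (f x)\<^sup>2)"
    by (intro integrable_circle_continuous continuous_intros assms)
  ultimately show ?thesis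
    using assms(2) by (simp add: circle_L2_def periodic_fun_simple_def)
qed

lemma integrable_circle_L2_mult:
  assumes "f \<in> circle_L2" "g \<in> circle_L2"
  shows "integrable circle_measure (\<lambda>x. f x * g x)"
proof (rule Bochner_Integration.integrable_bound)
  show "integrable circle_measure (\<lambda>x. (f x)\<^sup>2 + (g x)\<^sup>2)"
    using assms by (intro Bochner_Integration.integrable_add circle_L2_D(2))
  show "(\<lambda>x. f x * g x) \<in> borel_measurable circle_measure"
    using assms by (intro borel_measurable_times circle_L2_D(1))
  have "\<bar>f x * g x\<bar> \<le> (f x)\<^sup>2 + (g x)\<^sup>2" for x
    using sum_squares_bound[of "f x" "g x"] sum_squares_bound[of "f x" "- g x"]
    by (auto simp: abs_if)
  then show "AE x in circle_measure. norm (f x * g x) \<le> norm ((f x)\<^sup>2 + (g x)\<^sup>2)"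
    by auto
qed

lemma integrable_circle_L2:
  assumes "f \<in> circle_L2"
  shows "integrable circle_measure f"
  using integrable_circle_L2_mult[OF assms circle_L2_continuous[of "\<lambda>_. 1"]] by simp

lemma circle_L2_diff:
  assumes "f \<in> circle_L2" "g \<in> circle_L2"
  shows "(\<lambda>x. f x - g x) \<in> circle_L2"
proof -
  have "integrable circle_measure (\<lambda>x. (f x)\<^sup>2 + (g x)\<^sup>2 - 2 * (f x * g x))"
    using assms
    by (intro Bochner_Integration.integrable_add Bochner_Integration.integrable_diff
          integrable_mult_right circle_L2_D(2) integrable_circle_L2_mult)
  then have "integrable circle_measure (\<lambda>x. (f x - g x)\<^sup>2)"
    by (simp add: power2_diff algebra_simps)
  then show ?thesis
    using assms by (auto simp: circle_L2_def periodic_fun_simple_def)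
qed

lemma integrable_mult_continuous:
  fixes u e :: "real \<Rightarrow> real"
  assumes u: "integrable circle_measure u" and e: "continuous_on UNIV e"
  shows "integrable circle_measure (\<lambda>x. u x * e x)"
proof -
  have "bounded (e ` {0..2 * pi})"
    by (intro compact_imp_bounded compact_continuous_image continuous_on_subset[OF e]) auto
  then have "\<exists>B. \<forall>x\<in>{0..2 * pi}. \<bar>e x\<bar> \<le> B"
    by (auto simp: bounded_iff)
  then obtain B where B: "\<And>x. x \<in> {0..2 * pi} \<Longrightarrow> \<bar>e x\<bar> \<le> B"
    by blast
  show ?thesis
  proof (rule Bochner_Integration.integrable_bound)
    show "integrable circle_measure (\<lambda>x. B * u x)" using u by simp
    show "(\<lambda>x. u x * e x) \<in> borel_measurable circle_measure"
      using u integrable_circle_continuous[OF e]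
      by (intro borel_measurable_times borel_measurable_integrable)
    show "AE x in circle_measure. norm (u x * e x) \<le> norm (B * u x)"
    proof (rule AE_I2)
      fix x assume "x \<in> space circle_measure"
      then have "\<bar>e x\<bar> \<le> \<bar>B\<bar>" using B[of x] by auto
      then show "norm (u x * e x) \<le> norm (B * u x)"
        by (simp add: abs_mult mult.commute mult_right_mono)
    qed
  qed
qed

lemma circle_integral_FTC:
  assumes F: "\<And>x. (F has_real_derivative f x) (at x)" and f: "continuous_on UNIV f"
  shows "(\<integral>x. f x \<partial>circle_measure) = F (2 * pi) - F 0"
proof -
  have "(f has_integral F (2 * pi) - F 0) {0..2 * pi}"
    using F by (intro fundamental_theorem_of_calculus)
      (auto simp: has_real_derivative_iff_has_vector_derivative[symmetric]
            intro: has_field_derivative_at_within)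
  then show ?thesis
    using lebesgue_integral_eq_integral[OF integrable_circle_continuous[OF f]]
    by (simp add: integral_unique)
qed

lemma circle_integral_by_parts:
  assumes F: "\<And>x. (F has_real_derivative f x) (at x)" "continuous_on UNIV f"
      "F (2 * pi) = F 0"
    and G: "\<And>x. (G has_real_derivative g x) (at x)" "continuous_on UNIV g"
      "G (2 * pi) = G 0"
  shows "(\<integral>x. F x * g x \<partial>circle_measure) = - (\<integral>x. f x * G x \<partial>circle_measure)"
proof -
  have cF: "continuous_on UNIV F" and cG: "continuous_on UNIV G"
    using F(1) G(1) by (meson DERIV_isCont continuous_at_imp_continuous_on)+
  have "((\<lambda>x. F x * G x) has_real_derivative F x * g x + f x * G x) (at x)" for x
    using DERIV_mult[OF F(1)[of x] G(1)[of x]] by (simp add: algebra_simps)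
  from circle_integral_FTC[OF this]
  have "(\<integral>x. F x * g x + f x * G x \<partial>circle_measure) = 0"
    using F(2,3) G(2,3) cF cG by (simp add: continuous_on_add continuous_on_mult)
  moreover have "integrable circle_measure (\<lambda>x. F x * g x)" "integrable circle_measure (\<lambda>x. f x * G x)"
    by (intro integrable_circle_continuous continuous_intros F G cF cG)+
  ultimately show ?thesis by simp
qed

text \<open>
  The reflected translate \<open>\<phi> \<mapsto> f (\<theta> - \<phi>)\<close> maps \<open>[0, 2\<pi>]\<close> onto another period. With
  \<open>\<theta>\<close> reduced to \<open>t \<in> [0, 2\<pi>)\<close>, the piece over \<open>[0, t]\<close> is mapped onto \<open>[0, t]\<close>, and after
  adding a period the piece over \<open>(t, 2\<pi>]\<close> is mapped onto \<open>[t, 2\<pi>)\<close>.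
\<close>
lemma circle_integral_reflect:
  fixes f :: "real \<Rightarrow> real"
  assumes int: "integrable circle_measure f" and per: "\<And>x. f (x + 2 * pi) = f x"
  shows "integrable circle_measure (\<lambda>x. f (\<theta> - x))"
    and "(\<integral>x. f (\<theta> - x) \<partial>circle_measure) = (\<integral>x. f x \<partial>circle_measure)"
proof -
  interpret periodic_fun_simple f "2 * pi" by unfold_locales (fact per)
  define k where "k = \<lfloor>\<theta> / (2 * pi)\<rfloor>"
  define t where "t = \<theta> - of_int k * (2 * pi)"
  have "of_int k \<le> \<theta> / (2 * pi)" "\<theta> / (2 * pi) < of_int k + 1"
    by (auto simp: k_def)
  then have t: "0 \<le> t" "t < 2 * pi"
    by (auto simp: t_def field_simps)
  have shift: "f (\<theta> - x) = f (t - x)" for x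
    using plus_of_int[of "t - x" k] by (simp add: t_def algebra_simps)
  let ?f1 = "\<lambda>x. indicator {0..t} x * f x" and ?f2 = "\<lambda>x. indicator {t..<2 * pi} x * f x"
  have f: "integrable lebesgue (\<lambda>x. indicator {0..2 * pi} x * f x)"
    using int by (simp add: integrable_restrict_space)
  have "integrable lebesgue (\<lambda>x. indicator {0..t} x * (indicator {0..2 * pi} x * f x))"
    "integrable lebesgue (\<lambda>x. indicator {t..<2 * pi} x * (indicator {0..2 * pi} x * f x))"
    using integrable_mult_indicator[OF _ f, of "{0..t}"]
      integrable_mult_indicator[OF _ f, of "{t..<2 * pi}"] by simp_all
  moreover have "indicator {0..t} x * (indicator {0..2 * pi} x * f x) = ?f1 x"
    "indicator {t..<2 * pi} x * (indicator {0..2 * pi} x * f x) = ?f2 x" for x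
    using t by (auto simp: indicator_def)
  ultimately have i: "integrable lebesgue ?f1" "integrable lebesgue ?f2"
    by simp_all
  have "has_bochner_integral lebesgue (\<lambda>x. ?f1 (t + (-1) * x)) (integral\<^sup>L lebesgue ?f1)"
    "has_bochner_integral lebesgue (\<lambda>x. ?f2 ((t + 2 * pi) + (-1) * x)) (integral\<^sup>L lebesgue ?f2)"
    using has_bochner_integral_lebesgue_real_affine_iff[of "-1" ?f1 "integral\<^sup>L lebesgue ?f1" t]
      has_bochner_integral_lebesgue_real_affine_iff[of "-1" ?f2 "integral\<^sup>L lebesgue ?f2" "t + 2 * pi"] i
    by (simp_all add: has_bochner_integral_integrable)
  from has_bochner_integral_add[OF this]
  have "has_bochner_integral lebesgue (\<lambda>x. ?f1 (t - x) + ?f2 (t + 2 * pi - x))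
      (integral\<^sup>L lebesgue ?f1 + integral\<^sup>L lebesgue ?f2)"
    by simp
  moreover have "?f1 (t - x) + ?f2 (t + 2 * pi - x) = indicator {0..2 * pi} x * f (\<theta> - x)" for x
    using t per[of "t - x"] unfolding shift by (auto simp: indicator_def algebra_simps)
  ultimately have *: "has_bochner_integral lebesgue (\<lambda>x. indicator {0..2 * pi} x * f (\<theta> - x))
      (integral\<^sup>L lebesgue ?f1 + integral\<^sup>L lebesgue ?f2)"
    by simp
  have "AE x in lborel. x \<noteq> t" "AE x in lborel. x \<noteq> 2 * pi"
    by (rule AE_lborel_singleton)+
  then have AE_end: "AE x in lebesgue. x \<noteq> t \<and> x \<noteq> 2 * pi"
    by (intro AE_completion) auto
  have "integral\<^sup>L lebesgue ?f1 + integral\<^sup>L lebesgue ?f2 = (\<integral>x. ?f1 x + ?f2 x \<partial>lebesgue)"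
    using i by simp
  also have "\<dots> = (\<integral>x. indicator {0..2 * pi} x * f x \<partial>lebesgue)"
  proof (rule integral_cong_AE)
    show "AE x in lebesgue. ?f1 x + ?f2 x = indicator {0..2 * pi} x * f x"
      using AE_end by eventually_elim (use t in \<open>auto simp: indicator_def\<close>)
  qed (use i f in auto)
  finally have "integral\<^sup>L lebesgue ?f1 + integral\<^sup>L lebesgue ?f2 = (\<integral>x. f x \<partial>circle_measure)"
    by (simp add: integral_restrict_space)
  with * show "integrable circle_measure (\<lambda>x. f (\<theta> - x))"
    "(\<integral>x. f (\<theta> - x) \<partial>circle_measure) = (\<integral>x. f x \<partial>circle_measure)"
    by (auto simp: has_bochner_integral_iff integrable_restrict_space integral_restrict_space)
qed

text \<open>A set of full measure is dense, so a point of continuity is a limit of zeros of \<open>u\<close>.\<close>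
lemma AE_zero_isCont_imp_zero:
  fixes u :: "real \<Rightarrow> real"
  assumes ae: "AE x in circle_measure. u x = 0" and per: "\<And>x. u (x + 2 * pi) = u x"
    and cont: "isCont u \<theta>"
  shows "u \<theta> = 0"
proof (rule ccontr)
  assume ne: "u \<theta> \<noteq> 0"
  interpret periodic_fun_simple u "2 * pi" by unfold_locales (fact per)
  define k where "k = \<lfloor>\<theta> / (2 * pi)\<rfloor>"
  define t where "t = \<theta> - of_int k * (2 * pi)"
  have "of_int k \<le> \<theta> / (2 * pi)" "\<theta> / (2 * pi) < of_int k + 1"
    by (auto simp: k_def)
  then have t: "0 \<le> t" "t < 2 * pi"
    by (auto simp: t_def field_simps)
  have shift: "u (x + of_int k * (2 * pi)) = u x" for x
    by (rule plus_of_int)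
  obtain e where e: "e > 0" "\<And>y. dist \<theta> y < e \<Longrightarrow> u y \<noteq> 0"
    using continuous_at_avoid[OF cont ne] by auto
  define s where "s = min (t + e) (2 * pi)"
  have nz: "u x \<noteq> 0" if "x \<in> {t<..<s}" for x
    using e(2)[of "x + of_int k * (2 * pi)"] that
    by (auto simp: shift t_def s_def dist_real_def)
  have ae': "AE x in lebesgue. x \<in> {0..2 * pi} \<longrightarrow> u x = 0"
    using ae by (subst (asm) AE_restrict_space_iff) auto
  have "AE x in lebesgue. x \<notin> {t<..<s}"
    using ae' by eventually_elim (use nz t in \<open>auto simp: s_def\<close>)
  then have "{t<..<s} \<in> null_sets lebesgue"
    by (subst AE_iff_null_sets) auto
  moreover have "emeasure lebesgue {t<..<s} = ennreal (s - t)"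
    using t e by (auto simp: s_def)
  ultimately show False
    using t e by (auto simp: null_sets_def s_def)
qed

lemma continuous_square_integral_zero_imp_zero:
  fixes u :: "real \<Rightarrow> real"
  assumes cont: "continuous_on UNIV u" and per: "\<And>x. u (x + 2 * pi) = u x"
    and zero: "(\<integral>x. (u x)\<^sup>2 \<partial>circle_measure) = 0"
  shows "u \<theta> = 0"
proof (rule AE_zero_isCont_imp_zero[of u])
  have "integrable circle_measure (\<lambda>x. (u x)\<^sup>2)"
    by (intro integrable_circle_continuous continuous_intros cont)
  from integral_nonneg_eq_0_iff_AE[OF this] zero
  show "AE x in circle_measure. u x = 0" by auto
  show "isCont u \<theta>" using cont by (simp add: continuous_on_eq_continuous_at)
qed (fact per)

text \<open>
  The terms are dominated by \<open>\<bar>b n\<bar> \<bar>u x\<bar>\<close>, so the series may be integrated term by term.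
\<close>
lemma circle_integral_series:
  fixes u :: "real \<Rightarrow> real" and e :: "nat \<Rightarrow> real \<Rightarrow> real"
  assumes u: "integrable circle_measure u" and e: "\<And>n. continuous_on UNIV (e n)"
    and bound: "\<And>n x. \<bar>e n x\<bar> \<le> 1" and b: "summable (\<lambda>n. \<bar>b n\<bar>)"
  shows "(\<lambda>n. b n * (\<integral>x. u x * e n x \<partial>circle_measure)) sums
           (\<integral>x. u x * (\<Sum>n. b n * e n x) \<partial>circle_measure)"
proof -
  let ?f = "\<lambda>n x. b n * (u x * e n x)"
  have int: "integrable circle_measure (?f n)" for n
    by (intro integrable_mult_right integrable_mult_continuous u e)
  have s: "summable (\<lambda>n. norm (b n * e n x))" for x
    by (rule summable_comparison_test'[OF b, of 0])
       (use bound in \<open>auto simp: abs_mult intro: mult_left_le\<close>)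
  have ae: "AE x in circle_measure. summable (\<lambda>n. norm (?f n x))"
    using summable_mult[OF s, of "\<bar>u _\<bar>"]
    by (intro AE_I2) (simp add: abs_mult mult_ac)
  have "norm (\<integral>x. norm (?f n x) \<partial>circle_measure) \<le> \<bar>b n\<bar> * (\<integral>x. \<bar>u x\<bar> \<partial>circle_measure)" for n
  proof -
    have "(\<integral>x. norm (?f n x) \<partial>circle_measure) \<le> (\<integral>x. \<bar>b n\<bar> * \<bar>u x\<bar> \<partial>circle_measure)"
      using bound by (intro integral_mono integrable_norm int integrable_mult_right integrable_abs u)
        (auto simp: abs_mult intro!: mult_left_mono mult_left_le)
    then show ?thesis by simp
  qed
  then have sm: "summable (\<lambda>n. \<integral>x. norm (?f n x) \<partial>circle_measure)"
    by (intro summable_comparison_test'[OF summable_mult2[OF b], of 0]) auto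
  have eq: "(\<Sum>n. ?f n x) = u x * (\<Sum>n. b n * e n x)" for x
    using suminf_mult[OF summable_norm_cancel[OF s], of "u x" x] by (simp add: mult_ac)
  show "(\<lambda>n. b n * (\<integral>x. u x * e n x \<partial>circle_measure)) sums
           (\<integral>x. u x * (\<Sum>n. b n * e n x) \<partial>circle_measure)"
    using sums_integral[OF int ae sm] by (simp add: eq)
qed

section \<open>Trigonometric coefficients\<close>

text \<open>The squared norms of the functions \<open>cos l\<theta>\<close> in \<open>L\<^sup>2\<close> of the circle.\<close>
definition cos_norm :: "nat \<Rightarrow> real" where
  "cos_norm l = (if l = 0 then 2 * pi else pi)"

lemma cos_norm_pos: "cos_norm l > 0"
  by (simp add: cos_norm_def)

lemma cos_period: "cos (real l * (x + 2 * pi)) = cos (real l * x)"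
  using cos.plus_of_nat[of "real l * x" l] by (simp add: algebra_simps)

lemma sin_period: "sin (real l * (x + 2 * pi)) = sin (real l * x)"
  using sin.plus_of_nat[of "real l * x" l] by (simp add: algebra_simps)

lemma circle_integral_cos:
  "(\<integral>x. cos (of_int k * x) \<partial>circle_measure) = (if k = 0 then 2 * pi else 0)"
proof (cases "k = 0")
  case True
  then show ?thesis
    using circle_integral_FTC[of "\<lambda>x. x" "\<lambda>_. 1"] by simp
next
  case False
  have "(\<integral>x. cos (of_int k * x) \<partial>circle_measure)
      = sin (of_int k * (2 * pi)) / of_int k - sin (of_int k * 0) / of_int k"
    using False by (intro circle_integral_FTC) (auto intro!: derivative_eq_intros continuous_intros)
  moreover have "sin (of_int k * (2 * pi)) = 0"
    using sin_int_2pin[of k] by (simp add: mult_ac)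
  ultimately show ?thesis using False by simp
qed

lemma circle_integral_cos_cos:
  "(\<integral>x. cos (real l * x) * cos (real m * x) \<partial>circle_measure) = (if l = m then cos_norm l else 0)"
proof -
  have *: "cos (real l * x) * cos (real m * x) =
      (cos (of_int (int l - int m) * x) + cos (of_int (int l + int m) * x)) / 2" for x
    by (simp add: cos_times_cos algebra_simps)
  have "integrable circle_measure (\<lambda>x. cos (of_int k * x))" for k
    by (intro integrable_circle_continuous continuous_intros)
  then have "(\<integral>x. cos (real l * x) * cos (real m * x) \<partial>circle_measure) =
      ((\<integral>x. cos (of_int (int l - int m) * x) \<partial>circle_measure)
       + (\<integral>x. cos (of_int (int l + int m) * x) \<partial>circle_measure)) / 2"
    unfolding * by (simp del: of_int_diff of_int_add)
  then show ?thesis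
    unfolding circle_integral_cos by (auto simp: cos_norm_def)
qed

lemma circle_integral_sin_sin:
  assumes "l \<ge> 1" "m \<ge> 1"
  shows "(\<integral>x. sin (real l * x) * sin (real m * x) \<partial>circle_measure) = (if l = m then pi else 0)"
proof -
  have *: "sin (real l * x) * sin (real m * x) =
      (cos (of_int (int l - int m) * x) - cos (of_int (int l + int m) * x)) / 2" for x
    by (simp add: sin_times_sin algebra_simps)
  have "integrable circle_measure (\<lambda>x. cos (of_int k * x))" for k
    by (intro integrable_circle_continuous continuous_intros)
  then have "(\<integral>x. sin (real l * x) * sin (real m * x) \<partial>circle_measure) =
      ((\<integral>x. cos (of_int (int l - int m) * x) \<partial>circle_measure)
       - (\<integral>x. cos (of_int (int l + int m) * x) \<partial>circle_measure)) / 2"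
    unfolding * by (simp del: of_int_diff of_int_add)
  then show ?thesis
    using assms unfolding circle_integral_cos by auto
qed

text \<open>The left-hand side is the squared norm of the orthogonal projection of \<open>f\<close>.\<close>
lemma circle_Bessel:
  fixes f :: "real \<Rightarrow> real" and e :: "'i \<Rightarrow> real \<Rightarrow> real"
  assumes f: "f \<in> circle_L2" and I: "finite I"
    and e: "\<And>i. i \<in> I \<Longrightarrow> continuous_on UNIV (e i)"
    and orth: "\<And>i j. i \<in> I \<Longrightarrow> j \<in> I \<Longrightarrow>
      (\<integral>x. e i x * e j x \<partial>circle_measure) = (if i = j then n i else 0)"
    and n: "\<And>i. i \<in> I \<Longrightarrow> n i > 0"
  shows "(\<Sum>i\<in>I. (\<integral>x. f x * e i x \<partial>circle_measure)\<^sup>2 / n i) \<le> (\<integral>x. (f x)\<^sup>2 \<partial>circle_measure)"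
proof -
  define r where "r i = (\<integral>x. f x * e i x \<partial>circle_measure)" for i
  define t where "t i = r i / n i" for i
  define S where "S x = (\<Sum>i\<in>I. t i * e i x)" for x
  have S: "continuous_on UNIV S"
    unfolding S_def by (intro continuous_intros e)
  have fe: "integrable circle_measure (\<lambda>x. f x * e i x)" if "i \<in> I" for i
    using that by (intro integrable_mult_continuous integrable_circle_L2 f e)
  have Se: "integrable circle_measure (\<lambda>x. S x * e i x)" if "i \<in> I" for i
    using that by (intro integrable_circle_continuous continuous_intros S e)
  have ee: "integrable circle_measure (\<lambda>x. e i x * e j x)" if "i \<in> I" "j \<in> I" for i j
    using that by (intro integrable_circle_continuous continuous_intros e)
  have "(\<integral>x. f x * S x \<partial>circle_measure) = (\<integral>x. (\<Sum>i\<in>I. t i * (f x * e i x)) \<partial>circle_measure)"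
    by (simp add: S_def sum_distrib_left mult_ac)
  also have "\<dots> = (\<Sum>i\<in>I. t i * r i)"
    using fe by (simp add: r_def)
  finally have fS: "(\<integral>x. f x * S x \<partial>circle_measure) = (\<Sum>i\<in>I. t i * r i)" .
  have Sei: "(\<integral>x. S x * e i x \<partial>circle_measure) = r i" if "i \<in> I" for i
  proof -
    have "(\<integral>x. S x * e i x \<partial>circle_measure) = (\<integral>x. (\<Sum>j\<in>I. t j * (e j x * e i x)) \<partial>circle_measure)"
      by (simp add: S_def sum_distrib_right mult.assoc)
    also have "\<dots> = (\<Sum>j\<in>I. t j * (if j = i then n j else 0))"
      using that ee by (simp add: orth)
    also have "\<dots> = r i"
      using that I n[OF that] by (simp add: t_def if_distrib[of "\<lambda>z. _ * z"] cong: if_cong)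
    finally show ?thesis .
  qed
  have "(\<integral>x. S x * S x \<partial>circle_measure) = (\<integral>x. (\<Sum>i\<in>I. t i * (S x * e i x)) \<partial>circle_measure)"
    by (rule arg_cong[where f = "integral\<^sup>L circle_measure"], rule ext)
       (subst (2) S_def, simp add: sum_distrib_left mult_ac)
  also have "\<dots> = (\<Sum>i\<in>I. t i * r i)"
    using Se by (simp add: Sei)
  finally have SS: "(\<integral>x. S x * S x \<partial>circle_measure) = (\<Sum>i\<in>I. t i * r i)" .
  have "0 \<le> (\<integral>x. (f x - S x)\<^sup>2 \<partial>circle_measure)"
    by simp
  also have "\<dots> = (\<integral>x. (f x)\<^sup>2 - 2 * (f x * S x) + S x * S x \<partial>circle_measure)"
    by (simp add: power2_eq_square algebra_simps)
  also have "\<dots> = (\<integral>x. (f x)\<^sup>2 \<partial>circle_measure) - 2 * (\<Sum>i\<in>I. t i * r i) + (\<Sum>i\<in>I. t i * r i)"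
    using circle_L2_D(2)[OF f] integrable_mult_continuous[OF integrable_circle_L2[OF f] S]
      integrable_circle_continuous[of "\<lambda>x. S x * S x"] S
    by (simp add: fS SS continuous_on_mult)
  finally show ?thesis
    by (simp add: t_def r_def power2_eq_square)
qed

lemma circle_L2_partial_sum:
  "(\<lambda>x. \<Sum>l=0..N. b l * cos (real l * x)) \<in> circle_L2"
  by (rule circle_L2_continuous) (auto simp only: cos_period intro!: continuous_intros)

text \<open>
  For \<open>N \<ge> l\<close> the coefficient of \<open>f\<close> minus the \<open>N\<close>-th partial sum does not depend on \<open>N\<close>. The Bessel
  inequality for the single function \<open>cos l\<theta>\<close> bounds it by the \<open>L\<^sup>2\<close> distance, which tends to 0.
\<close>
lemma circle_L2_cos_coeff:
  assumes f: "f \<in> circle_L2" and s: "L2_sums_from 0 (\<lambda>l x. b l * cos (real l * x)) f"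
  shows "(\<integral>x. f x * cos (real l * x) \<partial>circle_measure) = cos_norm l * b l"
proof -
  define S where "S N x = (\<Sum>l=0..N. b l * cos (real l * x))" for N x
  let ?d = "(\<integral>x. f x * cos (real l * x) \<partial>circle_measure) - cos_norm l * b l"
  have fS: "(\<lambda>x. f x - S N x) \<in> circle_L2" for N
    unfolding S_def by (intro circle_L2_diff f circle_L2_partial_sum)
  have cc: "integrable circle_measure (\<lambda>x. cos (real k * x) * cos (real l * x))" for k
    by (intro integrable_circle_continuous continuous_intros)
  have "?d\<^sup>2 / cos_norm l \<le> (\<integral>x. (f x - S N x)\<^sup>2 \<partial>circle_measure)" if "N \<ge> l" for N
  proof -
    have "(\<integral>x. S N x * cos (real l * x) \<partial>circle_measure) =
       (\<integral>x. (\<Sum>k=0..N. b k * (cos (real k * x) * cos (real l * x))) \<partial>circle_measure)"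
      by (simp add: S_def sum_distrib_right mult.assoc)
    also have "\<dots> = (\<Sum>k=0..N. b k * (if k = l then cos_norm k else 0))"
      using cc by (simp add: circle_integral_cos_cos)
    also have "\<dots> = cos_norm l * b l"
      using that by (simp add: if_distrib[of "\<lambda>z. _ * z"] cong: if_cong)
    finally have "(\<integral>x. (f x - S N x) * cos (real l * x) \<partial>circle_measure) = ?d"
      using integrable_mult_continuous[OF integrable_circle_L2[OF f], of "\<lambda>x. cos (real l * x)"]
        integrable_mult_continuous[OF integrable_circle_L2[OF circle_L2_partial_sum], of "\<lambda>x. cos (real l * x)" b N]
      by (simp add: left_diff_distrib S_def continuous_intros)
    with circle_Bessel[OF fS, of "{l}" "\<lambda>_ x. cos (real l * x)" "\<lambda>_. cos_norm l" N]
    show ?thesis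
      by (simp add: circle_integral_cos_cos cos_norm_pos continuous_intros)
  qed
  then have "eventually (\<lambda>N. ?d\<^sup>2 / cos_norm l \<le> (\<integral>x. (f x - S N x)\<^sup>2 \<partial>circle_measure)) sequentially"
    by (rule eventually_sequentiallyI)
  moreover have "(\<lambda>N. \<integral>x. (f x - S N x)\<^sup>2 \<partial>circle_measure) \<longlonglongrightarrow> 0"
    using s by (simp add: L2_sums_from_def S_def)
  ultimately have "?d\<^sup>2 / cos_norm l \<le> 0"
    by (intro tendsto_lowerbound) auto
  then have "?d\<^sup>2 \<le> 0"
    using cos_norm_pos[of l] by (simp add: divide_le_0_iff)
  then show ?thesis by simp
qed

lemma summable_sin_coeff_square:
  assumes "f \<in> circle_L2"
  shows "summable (\<lambda>l. (\<integral>x. f x * sin (real l * x) \<partial>circle_measure)\<^sup>2)"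
proof (rule summableI_nonneg_bounded)
  fix N
  have "(\<Sum>l\<in>{1..<N}. (\<integral>x. f x * sin (real l * x) \<partial>circle_measure)\<^sup>2 / pi)
      \<le> (\<integral>x. (f x)\<^sup>2 \<partial>circle_measure)"
    by (rule circle_Bessel[OF assms]) (auto simp: circle_integral_sin_sin intro!: continuous_intros)
  moreover have "(\<Sum>l<N. (\<integral>x. f x * sin (real l * x) \<partial>circle_measure)\<^sup>2)
      = (\<Sum>l\<in>{1..<N}. (\<integral>x. f x * sin (real l * x) \<partial>circle_measure)\<^sup>2)"
    by (rule sum.mono_neutral_right) (auto simp: not_less_eq_eq Suc_le_eq)
  ultimately show "(\<Sum>l<N. (\<integral>x. f x * sin (real l * x) \<partial>circle_measure)\<^sup>2)
      \<le> pi * (\<integral>x. (f x)\<^sup>2 \<partial>circle_measure)"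
    by (simp add: sum_divide_distrib[symmetric] field_simps)
qed auto

lemma summable_cos_coeff_square:
  assumes "f \<in> circle_L2"
  shows "summable (\<lambda>l. (\<integral>x. f x * cos (real l * x) \<partial>circle_measure)\<^sup>2 / cos_norm l)"
proof (rule summableI_nonneg_bounded)
  show "(\<Sum>l<N. (\<integral>x. f x * cos (real l * x) \<partial>circle_measure)\<^sup>2 / cos_norm l)
      \<le> (\<integral>x. (f x)\<^sup>2 \<partial>circle_measure)" for N
    by (rule circle_Bessel[OF assms])
       (auto simp: circle_integral_cos_cos cos_norm_pos intro!: continuous_intros)
qed (simp add: cos_norm_pos less_imp_le)

lemma uniform_limit_cos_series:
  assumes "summable (\<lambda>l. \<bar>b l\<bar>)"
  shows "uniform_limit UNIV (\<lambda>N x. \<Sum>l<N. b l * cos (real l * x)) (\<lambda>x. \<Sum>l. b l * cos (real l * x)) sequentially"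
  by (rule Weierstrass_m_test[OF _ assms]) (simp add: abs_mult mult_left_le)

lemma uniform_limit_sin_series:
  assumes "summable (\<lambda>l. \<bar>b l\<bar>)"
  shows "uniform_limit UNIV (\<lambda>N x. \<Sum>l<N. b l * sin (real l * x)) (\<lambda>x. \<Sum>l. b l * sin (real l * x)) sequentially"
  by (rule Weierstrass_m_test[OF _ assms]) (simp add: abs_mult mult_left_le)

lemma continuous_cos_series:
  assumes "summable (\<lambda>l. \<bar>b l\<bar>)"
  shows "continuous_on UNIV (\<lambda>x. \<Sum>l. b l * cos (real l * x))"
  by (rule uniform_limit_theorem[OF _ uniform_limit_cos_series[OF assms]])
     (auto intro!: always_eventually continuous_intros)

lemma continuous_sin_series:
  assumes "summable (\<lambda>l. \<bar>b l\<bar>)"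
  shows "continuous_on UNIV (\<lambda>x. \<Sum>l. b l * sin (real l * x))"
  by (rule uniform_limit_theorem[OF _ uniform_limit_sin_series[OF assms]])
     (auto intro!: always_eventually continuous_intros)

lemma has_derivative_cos_series:
  assumes b: "summable (\<lambda>l. \<bar>b l\<bar>)" and lb: "summable (\<lambda>l. \<bar>real l * b l\<bar>)"
  shows "((\<lambda>x. \<Sum>l. b l * cos (real l * x)) has_real_derivative
           (\<Sum>l. - (real l * b l) * sin (real l * x))) (at x)"
proof (rule has_field_derivative_series'(2)[of UNIV _ _ 0])
  show "uniformly_convergent_on UNIV (\<lambda>n x. \<Sum>i<n. - (real i * b i) * sin (real i * x))"
    using uniform_limit_sin_series[of "\<lambda>l. - (real l * b l)"] lb
    by (intro uniformly_convergentI) auto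
  show "summable (\<lambda>n. b n * cos (real n * 0))"
    using summable_rabs_cancel[OF b] by simp
qed (auto intro!: derivative_eq_intros)

text \<open>
  The partial sums converge to \<open>f\<close> in \<open>L\<^sup>2\<close> and to the sum of the series uniformly, and so both
  limits agree in \<open>L\<^sup>2\<close>.
\<close>
lemma L2_sums_cos_AE:
  assumes f: "f \<in> circle_L2" and s: "L2_sums_from 0 (\<lambda>l x. b l * cos (real l * x)) f"
    and b: "summable (\<lambda>l. \<bar>b l\<bar>)"
  shows "AE x in circle_measure. f x = (\<Sum>l. b l * cos (real l * x))"
proof -
  define P where "P x = (\<Sum>l. b l * cos (real l * x))" for x
  define S where "S N x = (\<Sum>l=0..N. b l * cos (real l * x))" for N x
  have P: "continuous_on UNIV P"
    unfolding P_def by (rule continuous_cos_series[OF b])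
  have P2: "P \<in> circle_L2"
    by (rule circle_L2_continuous[OF P]) (simp only: P_def cos_period)
  have S2: "S N \<in> circle_L2" for N
    using circle_L2_partial_sum[where N = N] by (simp add: S_def[abs_def])
  have fP: "(\<lambda>x. f x - P x) \<in> circle_L2" by (intro circle_L2_diff f P2)
  have fS: "(\<lambda>x. f x - S N x) \<in> circle_L2" for N by (intro circle_L2_diff f S2)
  have SP: "(\<lambda>x. S N x - P x) \<in> circle_L2" for N by (intro circle_L2_diff P2 S2)
  have small: "(\<integral>x. (f x - P x)\<^sup>2 \<partial>circle_measure) \<le> e" if e: "e > 0" for e :: real
  proof -
    define d where "d = sqrt (e / (8 * pi))"
    have d: "d > 0" "d\<^sup>2 = e / (8 * pi)" using e by (auto simp: d_def)
    have "eventually (\<lambda>N. \<forall>x. dist (\<Sum>l<N. b l * cos (real l * x)) (P x) < d) sequentially"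
      using uniform_limit_cos_series[OF b] d(1) by (simp add: uniform_limit_iff P_def)
    then have "eventually (\<lambda>N. \<forall>x. dist (\<Sum>l<Suc N. b l * cos (real l * x)) (P x) < d) sequentially"
      by (rule eventually_compose_filterlim[OF _ filterlim_Suc])
    moreover have "eventually (\<lambda>N. (\<integral>x. (f x - S N x)\<^sup>2 \<partial>circle_measure) < e / 4) sequentially"
      using s e order_tendstoD(2)[of _ 0 sequentially "e / 4"] by (simp add: L2_sums_from_def S_def)
    ultimately have "eventually (\<lambda>N. (\<forall>x. \<bar>S N x - P x\<bar> < d) \<and>
        (\<integral>x. (f x - S N x)\<^sup>2 \<partial>circle_measure) < e / 4) sequentially"
      by eventually_elim (simp add: S_def dist_real_def atLeast0AtMost lessThan_Suc_atMost)
    then obtain N where N: "\<And>x. \<bar>S N x - P x\<bar> < d"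
        "(\<integral>x. (f x - S N x)\<^sup>2 \<partial>circle_measure) < e / 4"
      by (auto simp: eventually_sequentially)
    have "(f x - P x)\<^sup>2 \<le> 2 * (f x - S N x)\<^sup>2 + 2 * d\<^sup>2" for x
    proof -
      have "(S N x - P x)\<^sup>2 \<le> d\<^sup>2"
        using N(1)[of x] d(1) by (intro abs_le_square_iff[THEN iffD1]) auto
      moreover have "(f x - P x)\<^sup>2 \<le> 2 * (f x - S N x)\<^sup>2 + 2 * (S N x - P x)\<^sup>2"
        using sum_squares_bound[of "f x - S N x" "S N x - P x"]
        by (simp add: power2_eq_square algebra_simps)
      ultimately show ?thesis by linarith
    qed
    then have "(\<integral>x. (f x - P x)\<^sup>2 \<partial>circle_measure)
        \<le> (\<integral>x. 2 * (f x - S N x)\<^sup>2 + 2 * d\<^sup>2 \<partial>circle_measure)"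
      using circle_L2_D(2)[OF fP] circle_L2_D(2)[OF fS]
      by (intro integral_mono) (auto intro: integrable_circle_continuous)
    also have "\<dots> = 2 * (\<integral>x. (f x - S N x)\<^sup>2 \<partial>circle_measure) + 2 * pi * (2 * d\<^sup>2)"
      using circle_L2_D(2)[OF fS] by (simp add: integrable_circle_continuous measure_restrict_space)
    also have "\<dots> \<le> e" using N(2) d(2) by simp
    finally show ?thesis .
  qed
  then have "(\<integral>x. (f x - P x)\<^sup>2 \<partial>circle_measure) \<le> 0"
    by (rule field_le_epsilon[of _ 0, simplified])
  then have "(\<integral>x. (f x - P x)\<^sup>2 \<partial>circle_measure) = 0"
    by (intro antisym) auto
  then have "AE x in circle_measure. (f x - P x)\<^sup>2 = 0"
    using integral_nonneg_eq_0_iff_AE[OF circle_L2_D(2)[OF fP]] by simp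
  then show ?thesis by (simp add: P_def)
qed

text \<open>
  Completeness of the cosines among the even functions. An even function of the circle is a
  function of \<open>cos \<theta>\<close>, so by the Weierstrass theorem it is a uniform limit of polynomials in
  \<open>cos \<theta>\<close>; these are combinations of the \<open>cos l\<theta>\<close>. Thus \<open>f\<close> is orthogonal to itself.
\<close>
lemma even_orthogonal_cos_imp_zero:
  fixes f :: "real \<Rightarrow> real"
  assumes cont: "continuous_on UNIV f" and per: "\<And>x. f (x + 2 * pi) = f x"
    and even: "\<And>x. f (- x) = f x"
    and orth: "\<And>l. (\<integral>x. f x * cos (real l * x) \<partial>circle_measure) = 0"
  shows "f \<theta> = 0"
proof -
  have pow: "(\<integral>x. f x * (cos x ^ k * cos (real l * x)) \<partial>circle_measure) = 0" for k l
  proof (induction k arbitrary: l)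
    case 0
    show ?case using orth by simp
  next
    case (Suc k)
    define m where "m = (if l = 0 then 1 else l - 1)"
    have "cos x * cos (real l * x) = (cos (real (Suc l) * x) + cos (real m * x)) / 2" for x
      using cos_times_cos[of "real l * x" x]
      by (cases l) (auto simp: m_def algebra_simps)
    moreover have "f x * (cos x ^ Suc k * cos (real l * x)) = f x * cos x ^ k * (cos x * cos (real l * x))" for x
      by simp
    ultimately have eq: "f x * (cos x ^ Suc k * cos (real l * x)) =
        (f x * (cos x ^ k * cos (real (Suc l) * x)) + f x * (cos x ^ k * cos (real m * x))) / 2" for x
      by (simp add: add_divide_distrib distrib_left mult.assoc)
    have "integrable circle_measure (\<lambda>x. f x * (cos x ^ k * cos (real j * x)))" for j
      by (intro integrable_circle_continuous continuous_intros cont)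
    then show ?case
      unfolding eq using Suc.IH by (simp del: of_nat_Suc)
  qed
  \<comment> \<open>The powers of \<open>cos x\<close> are the case \<open>l = 0\<close>; the general \<open>l\<close> served the induction.\<close>
  have poly: "(\<integral>x. f x * q (cos x) \<partial>circle_measure) = 0" if q_poly: "real_polynomial_function q" for q
  proof -
    obtain a n where q: "q = (\<lambda>x. \<Sum>i\<le>n. a i * x ^ i)"
      using real_polynomial_function_imp_sum[OF q_poly] by blast
    have "integrable circle_measure (\<lambda>x. f x * cos x ^ i)" for i
      by (intro integrable_circle_continuous continuous_intros cont)
    then have "(\<integral>x. (\<Sum>i\<le>n. a i * (f x * cos x ^ i)) \<partial>circle_measure) = 0"
      using pow[of _ 0] by simp
    then show ?thesis
      by (simp add: q sum_distrib_left mult_ac)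
  qed
  define G where "G = (\<lambda>y. f (arccos y))"
  have G: "continuous_on {-1..1} G"
    unfolding G_def by (intro continuous_on_compose2[OF cont] continuous_intros) auto
  have fG: "f x = G (cos x)" if "x \<in> {0..2 * pi}" for x
  proof (cases "x \<le> pi")
    case True
    then show ?thesis using that by (simp add: G_def arccos_cos)
  next
    case False
    have "G (cos x) = G (cos (2 * pi - x))" by (simp add: cos_diff)
    moreover have "arccos (cos (2 * pi - x)) = - x + 2 * pi"
      using False that arccos_cos[of "2 * pi - x"] by simp
    then have "G (cos (2 * pi - x)) = f (- x + 2 * pi)"
      by (simp only: G_def)
    ultimately show ?thesis using per[of "- x"] even by simp
  qed
  define M where "M = (\<integral>x. \<bar>f x\<bar> \<partial>circle_measure)"
  have M: "M \<ge> 0" by (simp add: M_def)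
  have intf: "integrable circle_measure (\<lambda>x. \<bar>f x\<bar>)"
    by (intro integrable_circle_continuous continuous_intros cont)
  have "(\<integral>x. (f x)\<^sup>2 \<partial>circle_measure) \<le> 0 + e" if "e > 0" for e
  proof -
    define d where "d = e / (M + 1)"
    have d: "d > 0" "d * M \<le> e" using that M by (auto simp: d_def field_simps)
    obtain q where q: "real_polynomial_function q" "\<And>y. y \<in> {-1..1} \<Longrightarrow> \<bar>G y - q y\<bar> < d"
      using Stone_Weierstrass_real_polynomial_function[OF _ G d(1)] by auto
    have cq: "continuous_on UNIV (\<lambda>x. q (cos x))"
      by (rule continuous_on_compose2[OF continuous_on_polymonial_function])
         (use q(1) in \<open>auto simp: real_polynomial_function_eq intro!: continuous_intros\<close>)
    have "(\<integral>x. (f x)\<^sup>2 \<partial>circle_measure) = (\<integral>x. f x * f x - f x * q (cos x) \<partial>circle_measure)"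
      using poly[OF q(1)] by (subst Bochner_Integration.integral_diff)
        (auto intro!: integrable_circle_continuous continuous_intros cont cq simp: power2_eq_square)
    also have "\<dots> \<le> (\<integral>x. d * \<bar>f x\<bar> \<partial>circle_measure)"
    proof (rule integral_mono)
      fix x assume "x \<in> space circle_measure"
      then have "\<bar>f x - q (cos x)\<bar> \<le> d"
        using fG[of x] q(2)[of "cos x"] by (simp add: less_imp_le)
      then have "\<bar>f x * (f x - q (cos x))\<bar> \<le> d * \<bar>f x\<bar>"
        using mult_left_mono[of "\<bar>f x - q (cos x)\<bar>" d "\<bar>f x\<bar>"] by (simp add: abs_mult mult.commute)
      from abs_le_D1[OF this] show "f x * f x - f x * q (cos x) \<le> d * \<bar>f x\<bar>"
        by (simp add: algebra_simps)
    qed (intro integrable_circle_continuous continuous_intros cont cq)+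
    also have "\<dots> = d * M" by (simp add: M_def)
    finally show ?thesis using d(2) by simp
  qed
  then have "(\<integral>x. (f x)\<^sup>2 \<partial>circle_measure) \<le> 0"
    by (rule field_le_epsilon)
  then have "(\<integral>x. (f x)\<^sup>2 \<partial>circle_measure) = 0"
    by (intro antisym) auto
  then show ?thesis
    by (rule continuous_square_integral_zero_imp_zero[OF cont per])
qed

section \<open>Test functions and weak derivatives\<close>

lemma deriv_trig:
  "deriv (\<lambda>x. A * cos (real l * x) + B * sin (real l * x))
    = (\<lambda>x. (real l * B) * cos (real l * x) + (- (real l * A)) * sin (real l * x))"
  by (rule ext, rule DERIV_imp_deriv) (auto intro!: derivative_eq_intros)

lemma trig_circle_test:
  "(\<lambda>x. A * cos (real l * x) + B * sin (real l * x)) \<in> circle_test"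
proof -
  let ?t = "\<lambda>A B x. A * cos (real l * x) + B * sin (real l * x)"
  have diff: "?t A B field_differentiable (at y)" for A B y
    unfolding field_differentiable_def by (rule exI) (auto intro!: derivative_eq_intros)
  have form: "\<exists>A' B'. (deriv ^^ n) (?t A B) = ?t A' B'" for n
  proof (induction n)
    case 0
    show ?case by (intro exI[of _ A] exI[of _ B]) simp
  next
    case (Suc n)
    then obtain A' B' where "(deriv ^^ n) (?t A B) = ?t A' B'" by blast
    then have "(deriv ^^ Suc n) (?t A B) = ?t (real l * B') (- (real l * A'))"
      by (simp only: funpow.simps comp_apply deriv_trig)
    then show ?case by blast
  qed
  have "(deriv ^^ n) (?t A B) field_differentiable (at y)" for n y
    using form[of n] diff by fastforce
  then show ?thesis
    by (auto simp: circle_test_def periodic_fun_simple_def cos_period sin_period)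
qed

lemma cos_circle_test: "(\<lambda>x. cos (real l * x)) \<in> circle_test"
  using trig_circle_test[of 1 l 0] by simp

text \<open>
  Testing with \<open>sin l\<theta>\<close> determines the sine coefficients of a weak derivative; these are what
  enters the coefficient equations.
\<close>
lemma weak_deriv_sin_coeff:
  assumes "weak_deriv f g"
  shows "(\<integral>x. g x * sin (real l * x) \<partial>circle_measure) = - (real l * (\<integral>x. f x * cos (real l * x) \<partial>circle_measure))"
proof -
  have "(\<lambda>x. sin (real l * x)) \<in> circle_test"
    using trig_circle_test[of 0 l 1] by simp
  moreover have "deriv (\<lambda>x. sin (real l * x)) = (\<lambda>x. real l * cos (real l * x))"
    using deriv_trig[of 0 l 1] by simp
  ultimately have "(\<integral>x. real l * (f x * cos (real l * x)) \<partial>circle_measure)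
      = - (\<integral>x. g x * sin (real l * x) \<partial>circle_measure)"
    using assms by (auto simp: weak_deriv_def mult_ac)
  then show ?thesis by simp
qed

lemma circle_test_D:
  assumes "\<phi> \<in> circle_test"
  shows "(\<phi> has_real_derivative deriv \<phi> x) (at x)" "continuous_on UNIV (deriv \<phi>)"
    "\<phi> (x + 2 * pi) = \<phi> x"
proof -
  have d: "(deriv ^^ n) \<phi> field_differentiable (at y)" for n y
    using assms by (simp add: circle_test_def)
  show "(\<phi> has_real_derivative deriv \<phi> x) (at x)"
    using d[of 0] by (simp add: field_differentiable_derivI)
  show "continuous_on UNIV (deriv \<phi>)"
    using d[of 1] by (auto intro!: continuous_at_imp_continuous_on field_differentiable_imp_continuous_at)
  show "\<phi> (x + 2 * pi) = \<phi> x"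
    using assms by (simp add: circle_test_def periodic_fun_simple_def)
qed

lemma weak_deriv_classical:
  assumes F: "\<And>x. (F has_real_derivative f x) (at x)" "continuous_on UNIV f"
    "\<And>x. F (x + 2 * pi) = F x"
  shows "weak_deriv F f"
  unfolding weak_deriv_def
proof
  fix \<phi> assume \<phi>: "\<phi> \<in> circle_test"
  show "(\<integral>x. F x * deriv \<phi> x \<partial>circle_measure) = - (\<integral>x. f x * \<phi> x \<partial>circle_measure)"
    using F circle_test_D[OF \<phi>] F(3)[of 0] circle_test_D(3)[OF \<phi>, of 0]
    by (intro circle_integral_by_parts) auto
qed

lemma weak_deriv_cong_AE:
  assumes "AE x in circle_measure. f x = F x" "f \<in> circle_L2" "continuous_on UNIV F"
    and "weak_deriv F g"
  shows "weak_deriv f g"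
  unfolding weak_deriv_def
proof
  fix \<phi> assume \<phi>: "\<phi> \<in> circle_test"
  have "(\<integral>x. f x * deriv \<phi> x \<partial>circle_measure) = (\<integral>x. F x * deriv \<phi> x \<partial>circle_measure)"
  proof (rule integral_cong_AE)
    show "(\<lambda>x. f x * deriv \<phi> x) \<in> borel_measurable circle_measure"
      by (intro borel_measurable_integrable integrable_mult_continuous integrable_circle_L2
            assms circle_test_D[OF \<phi>])
    show "(\<lambda>x. F x * deriv \<phi> x) \<in> borel_measurable circle_measure"
      by (intro borel_measurable_integrable integrable_mult_continuous integrable_circle_continuous
            assms circle_test_D[OF \<phi>])
    show "AE x in circle_measure. f x * deriv \<phi> x = F x * deriv \<phi> x"
      using assms(1) by eventually_elim simp
  qed
  with assms(4) \<phi> show "(\<integral>x. f x * deriv \<phi> x \<partial>circle_measure) = - (\<integral>x. g x * \<phi> x \<partial>circle_measure)"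
    by (simp add: weak_deriv_def)
qed

section \<open>Products of a cosine and a sine series\<close>

text \<open>
  Since \<open>2 cos j\<theta> sin l\<theta> = sin (l + j)\<theta> + sin (l - j)\<theta>\<close>, the series in the second conclusion is, up
  to a factor, the \<open>l\<close>-th sine coefficient of the product of a cosine series with coefficients \<open>c\<close> and a sine
  series with coefficients \<open>B\<close>. The terms with \<open>B (l + j)\<close> for \<open>j \<ge> 1\<close>, renumbered, and the terms with
  \<open>B (j - l)\<close> for \<open>j > l\<close> combine into the infinite sum of the coefficient equations. The term
  \<open>2 * c 0 * B l\<close> arises once from each family, at \<open>j = 0\<close>.
\<close>
lemma sums_cos_sin_product_coeff:
  fixes B c :: "nat \<Rightarrow> real"
  assumes B: "summable (\<lambda>l. \<bar>B l\<bar>)" and c: "summable (\<lambda>l. \<bar>c l\<bar>)" and B0: "B 0 = 0"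
    and l: "l \<ge> 1"
  shows "(\<lambda>j. B j * c (j - l) - B (j - l) * c j) summable_on {l<..}"
    and "(\<lambda>j. c j * (B (l + j) + (if j \<le> l then B (l - j) else - B (j - l)))) sums
      (2 * c 0 * B l + (\<Sum>j=1..<l. B j * c (l - j))
        + (\<Sum>\<^sub>\<infinity>j\<in>{l<..}. B j * c (j - l) - B (j - l) * c j))"
proof -
  define X where "X j = c j * B (l + j)" for j
  define Y where "Y j = c j * (if j \<le> l then B (l - j) else - B (j - l))" for j
  define T where "T j = B j * c (j - l) - B (j - l) * c j" for j
  have "Bseq B"
    using summable_rabs_cancel[OF B] summable_imp_Bseq by blast
  then obtain K where K: "\<And>m. \<bar>B m\<bar> \<le> K"
    by (auto simp: Bseq_def)
  have K0: "0 \<le> K" using K[of 0] by simp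
  have "norm (norm (X j)) \<le> \<bar>c j\<bar> * K" "norm (norm (Y j)) \<le> \<bar>c j\<bar> * K" for j
    using K by (auto simp: X_def Y_def abs_mult intro!: mult_left_mono)
  then have X: "summable (\<lambda>j. norm (X j))" and Y: "summable (\<lambda>j. norm (Y j))"
    by (auto intro!: summable_comparison_test'[OF summable_mult2[OF c, of K], of 0])
  have X1: "summable (\<lambda>n. norm (X (n + 1)))" and Y1: "summable (\<lambda>n. norm (Y (n + (l + 1))))"
    using X Y by (simp_all only: summable_iff_shift[of "\<lambda>j. norm (X j)"] summable_iff_shift[of "\<lambda>j. norm (Y j)"])
  have T: "T (n + (l + 1)) = X (n + 1) + Y (n + (l + 1))" for n
    by (simp add: T_def X_def Y_def algebra_simps)
  have Tn: "summable (\<lambda>n. norm (T (n + (l + 1))))"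
    by (rule summable_comparison_test'[OF summable_add[OF X1 Y1], of 0])
       (simp only: T real_norm_def abs_abs abs_triangle_ineq)
  let ?S = "(\<Sum>n. X (n + 1)) + (\<Sum>n. Y (n + (l + 1)))"
  have "(\<lambda>n. T (n + (l + 1))) sums ?S"
    unfolding T by (intro sums_add summable_sums summable_norm_cancel[OF X1] summable_norm_cancel[OF Y1])
  with Tn have "((\<lambda>n. T (n + (l + 1))) has_sum ?S) UNIV"
    by (rule norm_summable_imp_has_sum)
  moreover have "{l<..} = (\<lambda>n. n + (l + 1)) ` UNIV"
  proof (intro equalityI subsetI)
    fix x assume "x \<in> {l<..}"
    then have "x = (x - (l + 1)) + (l + 1)" by simp
    then show "x \<in> (\<lambda>n. n + (l + 1)) ` UNIV" by blast
  qed auto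
  moreover have "inj (\<lambda>n. n + (l + 1))"
    by (simp add: inj_on_def)
  ultimately have hs: "(T has_sum ?S) {l<..}"
    using has_sum_reindex[of "\<lambda>n. n + (l + 1)" UNIV T ?S] by (simp add: comp_def)
  then show "(\<lambda>j. B j * c (j - l) - B (j - l) * c j) summable_on {l<..}"
    unfolding T_def summable_on_def by blast
  have "X sums ((\<Sum>n. X (n + 1)) + (\<Sum>i<1. X i))"
    by (rule sums_iff_shift[THEN iffD1], rule summable_sums, rule summable_norm_cancel, rule X1)
  moreover have "Y sums ((\<Sum>n. Y (n + (l + 1))) + (\<Sum>i<l + 1. Y i))"
    by (rule sums_iff_shift[THEN iffD1], rule summable_sums, rule summable_norm_cancel, rule Y1)
  moreover have "(\<Sum>i<l + 1. Y i) = c 0 * B l + (\<Sum>j=1..<l. B j * c (l - j))"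
  proof -
    have "(\<Sum>i<l + 1. Y i) = (\<Sum>i\<in>{0} \<union> {1..<l} \<union> {l}. Y i)"
      using l by (intro sum.cong) auto
    also have "\<dots> = Y 0 + (\<Sum>i=1..<l. Y i) + Y l"
      using l by (subst sum.union_disjoint; simp)+
    also have "(\<Sum>i=1..<l. Y i) = (\<Sum>j=1..<l. B j * c (l - j))"
      by (rule sum.reindex_bij_witness[of _ "\<lambda>j. l - j" "\<lambda>j. l - j"]) (auto simp: Y_def)
    finally show ?thesis using B0 by (simp add: Y_def)
  qed
  ultimately have "(\<lambda>j. X j + Y j) sums
      (2 * c 0 * B l + (\<Sum>j=1..<l. B j * c (l - j)) + ?S)"
    using sums_add[of X _ Y] by (fastforce simp: X_def algebra_simps)
  moreover have "(\<Sum>\<^sub>\<infinity>j\<in>{l<..}. B j * c (j - l) - B (j - l) * c j) = ?S"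
    using infsumI[OF hs] by (simp only: T_def[abs_def])
  ultimately show "(\<lambda>j. c j * (B (l + j) + (if j \<le> l then B (l - j) else - B (j - l)))) sums
      (2 * c 0 * B l + (\<Sum>j=1..<l. B j * c (l - j))
        + (\<Sum>\<^sub>\<infinity>j\<in>{l<..}. B j * c (j - l) - B (j - l) * c j))"
    by (simp add: X_def Y_def distrib_left)
qed

section \<open>The stationary equation in Fourier coefficients\<close>

text \<open>
  The convolution of \<open>W\<close> with \<open>cos l\<theta>\<close> is a multiple of \<open>cos l\<theta>\<close>: after the substitution
  \<open>\<phi> \<mapsto> \<theta> - \<phi>\<close> the addition theorem separates \<open>\<theta>\<close>, and the sine coefficients of the even
  function \<open>W\<close> vanish.
\<close>
lemma circle_conv_cos:
  assumes W: "W \<in> circle_L2" and even: "even_fun W"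
  shows "(\<integral>\<phi>. W (\<theta> - \<phi>) * cos (real l * \<phi>) \<partial>circle_measure)
    = cos (real l * \<theta>) * (\<integral>x. W x * cos (real l * x) \<partial>circle_measure)"
proof -
  have cos_int: "integrable circle_measure (\<lambda>x. W x * cos (real l * x))"
    and sin_int: "integrable circle_measure (\<lambda>x. W x * sin (real l * x))"
    by (intro integrable_mult_continuous integrable_circle_L2 W continuous_intros)+
  have "(\<integral>x. W (0 - x) * sin (real l * (0 - x)) \<partial>circle_measure) = (\<integral>x. W x * sin (real l * x) \<partial>circle_measure)"
    by (rule circle_integral_reflect(2)[OF sin_int]) (simp only: circle_L2_D(3)[OF W] sin_period)
  moreover have odd: "W (0 - x) * sin (real l * (0 - x)) = - (W x * sin (real l * x))" for x
    using even by (simp add: even_fun_def)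
  ultimately have sin0: "(\<integral>x. W x * sin (real l * x) \<partial>circle_measure) = 0"
    unfolding odd by simp
  have cos_sub: "cos (real l * (\<theta> - x)) = cos (real l * \<theta>) * cos (real l * x) + sin (real l * \<theta>) * sin (real l * x)" for x
    by (simp add: right_diff_distrib cos_diff)
  have "(\<integral>x. W (\<theta> - x) * cos (real l * (\<theta> - (\<theta> - x))) \<partial>circle_measure)
      = (\<integral>x. W x * cos (real l * (\<theta> - x)) \<partial>circle_measure)"
  proof (rule circle_integral_reflect(2))
    show "integrable circle_measure (\<lambda>x. W x * cos (real l * (\<theta> - x)))"
      by (intro integrable_mult_continuous integrable_circle_L2 W continuous_intros)
    have "cos (real l * (\<theta> - (x + 2 * pi))) = cos (real l * (\<theta> - x))" for x
      using cos_period[of l "\<theta> - (x + 2 * pi)"] by (simp add: algebra_simps)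
    then show "W (x + 2 * pi) * cos (real l * (\<theta> - (x + 2 * pi))) = W x * cos (real l * (\<theta> - x))" for x
      by (simp only: circle_L2_D(3)[OF W])
  qed
  also have "\<dots> = (\<integral>x. cos (real l * \<theta>) * (W x * cos (real l * x)) + sin (real l * \<theta>) * (W x * sin (real l * x)) \<partial>circle_measure)"
    unfolding cos_sub by (simp add: distrib_left mult_ac)
  also have "\<dots> = cos (real l * \<theta>) * (\<integral>x. W x * cos (real l * x) \<partial>circle_measure)"
    using cos_int sin_int by (simp add: sin0)
  finally show ?thesis by simp
qed

text \<open>
  The series of \<open>W\<close> starts at \<open>l = 1\<close> and says nothing about a coefficient with index 0. The sequence
  \<open>b\<close> extends the coefficients of \<open>W\<close> by \<open>b 0 = 0\<close>, so that all series start at 0.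
\<close>
locale mckean_vlasov =
  fixes \<kappa> :: real and W p :: "real \<Rightarrow> real" and b c :: "nat \<Rightarrow> real"
  assumes W_L2: "W \<in> circle_L2" and W_even: "even_fun W"
    and W_series: "L2_sums_from 0 (\<lambda>l x. b l * cos (real l * x)) W" and b_0: "b 0 = 0"
    and p_H1: "p \<in> H1_s"
    and p_series: "L2_sums_from 0 (\<lambda>l x. (2 * c l) * cos (real l * x)) p"
begin

text \<open>
  \<open>P\<close> is the continuous representative of \<open>p\<close>, \<open>V\<close> is the convolution of \<open>W\<close> and \<open>p\<close>, and \<open>V'\<close> is its
  classical derivative. The three series converge absolutely: \<open>l c\<^sub>l\<close> is square summable because
  \<open>p\<close> has a square integrable weak derivative, and \<open>b\<^sub>l\<close> is square summable because \<open>W\<close> is square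
  integrable.
\<close>
definition P where "P x = (\<Sum>l. (2 * c l) * cos (real l * x))"
definition V where "V x = (\<Sum>l. (b l * c l) * cos (real l * x))"
definition V' where "V' x = (\<Sum>l. - (real l * (b l * c l)) * sin (real l * x))"

lemma p_L2: "p \<in> circle_L2"
  using p_H1 by (simp add: H1_s_def)

lemma p_cos: "(\<integral>x. p x * cos (real l * x) \<partial>circle_measure) = cos_norm l * (2 * c l)"
  by (rule circle_L2_cos_coeff[OF p_L2 p_series])

lemma W_cos: "(\<integral>x. W x * cos (real l * x) \<partial>circle_measure) = pi * b l"
proof -
  have "cos_norm l * b l = pi * b l"
    using b_0 by (cases "l = 0") (auto simp: cos_norm_def)
  then show ?thesis
    using circle_L2_cos_coeff[OF W_L2 W_series, of l] by simp
qed

lemma weak_deriv_p_sin: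
  assumes "weak_deriv p g"
  shows "(\<integral>x. g x * sin (real l * x) \<partial>circle_measure) = - (2 * pi * (real l * c l))"
  using weak_deriv_sin_coeff[OF assms, of l] by (simp add: p_cos cos_norm_def)

lemma summable_lc_square: "summable (\<lambda>l. (real l * c l)\<^sup>2)"
proof -
  obtain g where "g \<in> circle_L2" "weak_deriv p g"
    using p_H1 by (auto simp: H1_s_def)
  then have "summable (\<lambda>l. (2 * pi)\<^sup>2 * (real l * c l)\<^sup>2)"
    using summable_sin_coeff_square[of g] by (simp add: weak_deriv_p_sin power_mult_distrib)
  then show ?thesis by simp
qed

lemma summable_c: "summable (\<lambda>l. \<bar>c l\<bar>)"
proof (rule summable_comparison_test')
  show "summable (\<lambda>l. (real l * c l)\<^sup>2 + inverse (real l ^ 2))"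
    by (intro summable_add summable_lc_square inverse_power_summable) simp
  fix l :: nat assume "1 \<le> l"
  then have "2 * \<bar>c l\<bar> = 2 * \<bar>real l * c l\<bar> * inverse (real l)"
    by (simp add: abs_mult)
  also have "\<dots> \<le> (real l * c l)\<^sup>2 + inverse (real l ^ 2)"
    using sum_squares_bound[of "\<bar>real l * c l\<bar>" "inverse (real l)"] by (simp add: power_inverse)
  finally show "norm \<bar>c l\<bar> \<le> (real l * c l)\<^sup>2 + inverse (real l ^ 2)"
    by simp
qed

lemma summable_lbc: "summable (\<lambda>l. \<bar>real l * (b l * c l)\<bar>)"
proof (rule summable_comparison_test')
  have "(\<integral>x. W x * cos (real l * x) \<partial>circle_measure)\<^sup>2 / cos_norm l = pi * (b l)\<^sup>2" for l
    using b_0 W_cos[of 0] by (cases "l = 0") (auto simp: W_cos cos_norm_def power2_eq_square)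
  then have "summable (\<lambda>l. pi * (b l)\<^sup>2)"
    using summable_cos_coeff_square[OF W_L2] by simp
  then show "summable (\<lambda>l. (real l * c l)\<^sup>2 + (b l)\<^sup>2)"
    by (intro summable_add summable_lc_square) simp
  fix l :: nat
  have "2 * \<bar>real l * (b l * c l)\<bar> \<le> (real l * c l)\<^sup>2 + (b l)\<^sup>2"
    using sum_squares_bound[of "\<bar>real l * c l\<bar>" "\<bar>b l\<bar>"] by (simp add: abs_mult power_mult_distrib mult_ac)
  then show "norm \<bar>real l * (b l * c l)\<bar> \<le> (real l * c l)\<^sup>2 + (b l)\<^sup>2"
    by simp
qed

lemma summable_bc: "summable (\<lambda>l. \<bar>b l * c l\<bar>)"
proof (rule summable_comparison_test'[OF summable_lbc])
  fix l :: nat assume "1 \<le> l"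
  then show "norm \<bar>b l * c l\<bar> \<le> \<bar>real l * (b l * c l)\<bar>"
    using mult_right_mono[of 1 "real l" "\<bar>b l * c l\<bar>"] by (simp add: abs_mult)
qed

lemma summable_2c: "summable (\<lambda>l. \<bar>2 * c l\<bar>)"
  using summable_mult[OF summable_c, of 2] by (simp add: abs_mult)

lemma P_continuous: "continuous_on UNIV P"
  unfolding P_def by (rule continuous_cos_series[OF summable_2c])

lemma V_deriv: "(V has_real_derivative V' x) (at x)"
  using has_derivative_cos_series[OF summable_bc summable_lbc, of x] by (simp only: V_def[abs_def] V'_def)

lemma V'_continuous: "continuous_on UNIV V'"
  unfolding V'_def using summable_lbc by (intro continuous_sin_series) (simp only: abs_minus_cancel minus_mult_left[symmetric])

lemma V_continuous: "continuous_on UNIV V"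
  using V_deriv by (meson DERIV_isCont continuous_at_imp_continuous_on)

lemma P_period: "P (x + 2 * pi) = P x"
  by (simp only: P_def cos_period)

lemma V_period: "V (x + 2 * pi) = V x"
  by (simp only: V_def cos_period)

lemma V'_period: "V' (x + 2 * pi) = V' x"
  by (simp only: V'_def sin_period)

lemma P_even: "P (- x) = P x"
  by (simp add: P_def)

lemma V'_odd: "V' (- x) = - V' x"
proof -
  have "summable (\<lambda>l. - (real l * (b l * c l)) * sin (real l * x))"
    by (rule summable_comparison_test'[OF summable_lbc, of 0]) (simp add: abs_mult mult_left_le)
  from suminf_minus[OF this] show ?thesis by (simp add: V'_def)
qed

lemma V'_L2: "V' \<in> circle_L2"
  by (rule circle_L2_continuous[OF V'_continuous V'_period])

lemma weak_deriv_V: "weak_deriv V V'"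
  by (rule weak_deriv_classical[OF V_deriv V'_continuous V_period])

lemma p_eq_P: "AE x in circle_measure. p x = P x"
  unfolding P_def by (rule L2_sums_cos_AE[OF p_L2 p_series summable_2c])

lemma integral_p_mult:
  assumes "v \<in> circle_L2" "continuous_on UNIV e"
  shows "(\<integral>x. p x * v x * e x \<partial>circle_measure) = (\<integral>x. (v x * e x) * P x \<partial>circle_measure)"
proof (rule integral_cong_AE)
  show "(\<lambda>x. p x * v x * e x) \<in> borel_measurable circle_measure"
    by (intro borel_measurable_integrable integrable_mult_continuous integrable_circle_L2_mult p_L2 assms)
  show "(\<lambda>x. (v x * e x) * P x) \<in> borel_measurable circle_measure"
    by (intro borel_measurable_integrable integrable_mult_continuous integrable_circle_L2 P_continuous assms)
  show "AE x in circle_measure. p x * v x * e x = (v x * e x) * P x"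
    using p_eq_P by eventually_elim simp
qed

lemma circle_conv_eq_V: "circle_conv W p = V"
proof
  fix \<theta>
  have u: "integrable circle_measure (\<lambda>\<phi>. W (\<theta> - \<phi>))"
    by (rule circle_integral_reflect(1)[OF integrable_circle_L2[OF W_L2] circle_L2_D(3)[OF W_L2]])
  have "(\<integral>\<phi>. W (\<theta> - \<phi>) * p \<phi> \<partial>circle_measure) = (\<integral>\<phi>. W (\<theta> - \<phi>) * P \<phi> \<partial>circle_measure)"
  proof (rule integral_cong_AE)
    show "(\<lambda>\<phi>. W (\<theta> - \<phi>) * p \<phi>) \<in> borel_measurable circle_measure"
      by (intro borel_measurable_times borel_measurable_integrable[OF u] circle_L2_D(1) p_L2)
    show "(\<lambda>\<phi>. W (\<theta> - \<phi>) * P \<phi>) \<in> borel_measurable circle_measure"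
      by (intro borel_measurable_integrable integrable_mult_continuous u P_continuous)
    show "AE \<phi> in circle_measure. W (\<theta> - \<phi>) * p \<phi> = W (\<theta> - \<phi>) * P \<phi>"
      using p_eq_P by eventually_elim simp
  qed
  moreover have "(\<lambda>l. (2 * c l) * (\<integral>\<phi>. W (\<theta> - \<phi>) * cos (real l * \<phi>) \<partial>circle_measure)) sums
      (\<integral>\<phi>. W (\<theta> - \<phi>) * P \<phi> \<partial>circle_measure)"
    unfolding P_def by (rule circle_integral_series[OF u _ _ summable_2c]) (auto intro: continuous_intros)
  then have "(\<lambda>l. 1 / (2 * pi) * ((2 * c l) * (\<integral>\<phi>. W (\<theta> - \<phi>) * cos (real l * \<phi>) \<partial>circle_measure))) sums
      (1 / (2 * pi) * (\<integral>\<phi>. W (\<theta> - \<phi>) * P \<phi> \<partial>circle_measure))"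
    by (rule sums_mult)
  moreover have "1 / (2 * pi) * ((2 * c l) * (\<integral>\<phi>. W (\<theta> - \<phi>) * cos (real l * \<phi>) \<partial>circle_measure))
      = (b l * c l) * cos (real l * \<theta>)" for l
    by (simp add: circle_conv_cos[OF W_L2 W_even] W_cos)
  ultimately show "circle_conv W p \<theta> = V \<theta>"
    by (simp add: circle_conv_def V_def sums_iff)
qed

lemma V_cos: "(\<integral>x. V x * cos (real m * x) \<partial>circle_measure) = pi * (b m * c m)"
proof -
  have "(\<lambda>l. (b l * c l) * (\<integral>x. cos (real m * x) * cos (real l * x) \<partial>circle_measure)) sums
      (\<integral>x. cos (real m * x) * V x \<partial>circle_measure)"
    unfolding V_def
    by (rule circle_integral_series[OF integrable_circle_continuous _ _ summable_bc])
       (auto intro: continuous_intros)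
  moreover have "(b l * c l) * (\<integral>x. cos (real m * x) * cos (real l * x) \<partial>circle_measure)
      = (if l = m then pi * (b l * c l) else 0)" for l
    using b_0 by (simp add: circle_integral_cos_cos cos_norm_def)
  ultimately have "(\<lambda>l. if l = m then pi * (b l * c l) else 0) sums (\<integral>x. cos (real m * x) * V x \<partial>circle_measure)"
    by simp
  from sums_unique2[OF this sums_single] show ?thesis
    by (simp add: mult.commute)
qed

lemma coeff_tail_eq:
  "coeff_tail b c l j = real j * (b j * c j) * c (j - l) - real (j - l) * (b (j - l) * c (j - l)) * c j"
  by (simp add: coeff_tail_def algebra_simps)

text \<open>
  The uniformly convergent cosine series of \<open>p\<close> is multiplied by \<open>v sin l\<theta>\<close> and integrated term by
  term; the products \<open>cos j\<theta> sin l\<theta>\<close> reduce each term to sine coefficients of \<open>v\<close>, which are those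
  of the derivative of \<open>V\<close>.
\<close>
lemma product_sin_coeff:
  assumes v: "v \<in> circle_L2" and V: "weak_deriv V v" and l: "l \<ge> 1"
  shows "coeff_tail b c l summable_on {l<..}"
    and "(\<integral>x. p x * v x * sin (real l * x) \<partial>circle_measure) =
      - (pi * (2 * c 0 * (real l * (b l * c l))
        + (\<Sum>j=1..<l. real j * b j * c j * c (l - j)) + (\<Sum>\<^sub>\<infinity>j\<in>{l<..}. coeff_tail b c l j)))"
proof -
  define B where "B m = real m * (b m * c m)" for m
  have vs: "(\<integral>x. v x * sin (real m * x) \<partial>circle_measure) = - (pi * B m)" for m
    using weak_deriv_sin_coeff[OF V, of m] by (simp add: V_cos B_def)
  have vi: "integrable circle_measure (\<lambda>x. v x * sin (real m * x))" for m
    by (intro integrable_mult_continuous integrable_circle_L2 v continuous_intros)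
  have vsc: "(\<integral>x. (v x * sin (real l * x)) * cos (real j * x) \<partial>circle_measure)
      = - (pi / 2 * (B (l + j) + (if j \<le> l then B (l - j) else - B (j - l))))" for j
  proof (cases "j \<le> l")
    case True
    then have "sin (real l * x) * cos (real j * x) = (sin (real (l + j) * x) + sin (real (l - j) * x)) / 2" for x
      by (simp add: sin_times_cos of_nat_diff left_diff_distrib distrib_right)
    then have eq: "v x * sin (real l * x) * cos (real j * x)
        = (v x * sin (real (l + j) * x) + v x * sin (real (l - j) * x)) / 2" for x
      by (simp add: algebra_simps)
    have "(\<integral>x. (v x * sin (real l * x)) * cos (real j * x) \<partial>circle_measure)
        = (- (pi * B (l + j)) + - (pi * B (l - j))) / 2"
      unfolding eq by (simp add: vi vs del: of_nat_add of_nat_diff)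
    then show ?thesis
      using True by (simp add: field_simps)
  next
    case False
    then have s: "sin (real l * x) * cos (real j * x) = (sin (real (l + j) * x) - sin (real (j - l) * x)) / 2" for x
      using sin_minus[of "real (j - l) * x"]
      by (simp add: sin_times_cos of_nat_diff left_diff_distrib distrib_right)
    have eq: "v x * sin (real l * x) * cos (real j * x)
        = (v x * sin (real (l + j) * x) - v x * sin (real (j - l) * x)) / 2" for x
      unfolding mult.assoc s by (simp add: right_diff_distrib)
    have "(\<integral>x. (v x * sin (real l * x)) * cos (real j * x) \<partial>circle_measure)
        = (- (pi * B (l + j)) - - (pi * B (j - l))) / 2"
      unfolding eq by (simp add: vi vs del: of_nat_add of_nat_diff)
    then show ?thesis
      using False by (simp add: field_simps)
  qed
  have B: "summable (\<lambda>l. \<bar>B l\<bar>)" "B 0 = 0"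
    using summable_lbc by (auto simp: B_def)
  note key = sums_cos_sin_product_coeff[OF B(1) summable_c B(2) l]
  have tail: "coeff_tail b c l = (\<lambda>j. B j * c (j - l) - B (j - l) * c j)"
    by (rule ext) (simp add: coeff_tail_eq B_def)
  show "coeff_tail b c l summable_on {l<..}"
    using key(1) by (simp only: tail)
  have "(\<lambda>j. (2 * c j) * (\<integral>x. (v x * sin (real l * x)) * cos (real j * x) \<partial>circle_measure)) sums
      (\<integral>x. (v x * sin (real l * x)) * P x \<partial>circle_measure)"
    unfolding P_def by (rule circle_integral_series[OF vi _ _ summable_2c]) (auto intro: continuous_intros)
  moreover have "(2 * c j) * (\<integral>x. (v x * sin (real l * x)) * cos (real j * x) \<partial>circle_measure)
      = - pi * (c j * (B (l + j) + (if j \<le> l then B (l - j) else - B (j - l))))" for j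
    unfolding vsc by simp
  ultimately have "(\<lambda>j. - pi * (c j * (B (l + j) + (if j \<le> l then B (l - j) else - B (j - l))))) sums
      (\<integral>x. (v x * sin (real l * x)) * P x \<partial>circle_measure)"
    by simp
  from sums_unique2[OF this sums_mult[OF key(2), of "- pi"]]
  show "(\<integral>x. p x * v x * sin (real l * x) \<partial>circle_measure) =
      - (pi * (2 * c 0 * (real l * (b l * c l))
        + (\<Sum>j=1..<l. real j * b j * c j * c (l - j)) + (\<Sum>\<^sub>\<infinity>j\<in>{l<..}. coeff_tail b c l j)))"
    unfolding integral_p_mult[OF v, of "\<lambda>x. sin (real l * x)", OF continuous_on_sin[OF continuous_on_mult_left[OF continuous_on_id]]] tail
    by (simp add: B_def mult.assoc)
qed

text \<open>
  The \<open>l\<close>-th coefficient equation is the stationary equation tested with \<open>cos l\<theta>\<close>. With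
  \<open>c 0 = 1 / 2\<close> the term \<open>2 * c 0 * (real l * (b l * c l))\<close> becomes the contribution
  \<open>- \<kappa> b\<^sub>l\<close> to the factor \<open>2 - \<kappa> b\<^sub>l\<close> on the left-hand side.
\<close>
lemma coeff_equation_iff:
  assumes g: "weak_deriv p g" and v: "v \<in> circle_L2" "weak_deriv V v"
    and l: "l \<ge> 1" and c0: "c 0 = 1 / 2"
  shows "coeff_equation \<kappa> b c l \<longleftrightarrow>
    (\<integral>x. g x * sin (real l * x) \<partial>circle_measure) = \<kappa> * (\<integral>x. p x * v x * sin (real l * x) \<partial>circle_measure)"
proof -
  define F where "F = (\<Sum>j=1..<l. real j * b j * c j * c (l - j))"
  define T where "T = (\<Sum>\<^sub>\<infinity>j\<in>{l<..}. coeff_tail b c l j)"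
  have "coeff_equation \<kappa> b c l \<longleftrightarrow> 2 * (real l * c l) = \<kappa> * (real l * (b l * c l) + F + T)"
    unfolding coeff_equation_def F_def[symmetric] T_def[symmetric] by (auto simp: algebra_simps)
  also have "\<dots> \<longleftrightarrow> pi * (2 * (real l * c l)) = pi * (\<kappa> * (real l * (b l * c l) + F + T))"
    by simp
  also have "\<dots> \<longleftrightarrow> - (2 * pi * (real l * c l)) = \<kappa> * (- (pi * (2 * c 0 * (real l * (b l * c l)) + F + T)))"
    unfolding c0 by (simp add: mult_ac)
  finally show ?thesis
    unfolding weak_deriv_p_sin[OF g] product_sin_coeff(2)[OF v l] F_def T_def .
qed

end

section \<open>The exponential formula\<close>

context mckean_vlasov
begin

lemma integral_p:
  assumes c0: "c 0 = 1 / 2"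
  shows "(\<integral>x. p x \<partial>circle_measure) = 2 * pi"
  using p_cos[of 0] c0 by (simp add: cos_norm_def)

text \<open>
  The series of \<open>P\<close> cannot be differentiated term by term, as \<open>l c\<^sub>l\<close> is only known to be square
  summable. Instead, the function \<open>h = \<kappa> P V'\<close> is continuous and odd, so
  it has an even periodic antiderivative \<open>H\<close>. The coefficient equations say that \<open>h\<close> has the
  sine coefficients of the weak derivative of \<open>p\<close>; hence \<open>P\<close> and \<open>H\<close> differ by a constant, and
  \<open>P' = \<kappa> P V'\<close>.
\<close>
lemma P_deriv:
  assumes c0: "c 0 = 1 / 2" and eq: "\<And>l. l \<ge> 1 \<Longrightarrow> coeff_equation \<kappa> b c l"
  shows "(P has_real_derivative \<kappa> * (P x * V' x)) (at x)"
proof -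
  define h where "h x = \<kappa> * (P x * V' x)" for x
  have h: "continuous_on UNIV h"
    unfolding h_def by (intro continuous_intros P_continuous V'_continuous)
  have h_odd: "h (- x) = - h x" and h_per: "h (x + 2 * pi) = h x" for x
    by (simp_all only: h_def P_even V'_odd P_period V'_period mult_minus_right)
  have "\<exists>H. \<forall>x. - \<infinity> < ereal x \<longrightarrow> ereal x < \<infinity> \<longrightarrow> (H has_vector_derivative h x) (at x)"
    using h by (intro einterval_antiderivative) (auto simp: continuous_on_eq_continuous_at)
  then obtain H where H: "\<And>x. (H has_real_derivative h x) (at x)"
    by (auto simp: has_real_derivative_iff_has_vector_derivative)
  have H_cont: "continuous_on UNIV H"
    using H by (meson DERIV_isCont continuous_at_imp_continuous_on)
  have Hneg: "((\<lambda>x. H (- x)) has_real_derivative h x) (at x)" for x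
    using DERIV_chain2[OF H[of "- x"] DERIV_minus[OF DERIV_ident]] by (simp add: h_odd)
  have "((\<lambda>x. H (- x) - H x) has_real_derivative 0) (at x)" for x
    using DERIV_diff[OF Hneg[of x] H[of x]] by simp
  then have H_even: "H (- x) = H x" for x
    using DERIV_isconst_all[of "\<lambda>x. H (- x) - H x" x 0] by simp
  \<comment> \<open>The increment over a period is constant; at \<open>- pi\<close> it is 0 as \<open>H\<close> is even.\<close>
  have "((\<lambda>x. H (x + 2 * pi)) has_real_derivative h x) (at x)" for x
    using DERIV_shift[of H "h x" x "2 * pi"] H[of "x + 2 * pi"] by (simp add: h_per)
  then have "((\<lambda>x. H (x + 2 * pi) - H x) has_real_derivative 0) (at x)" for x
    using DERIV_diff[OF _ H[of x]] by fastforce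
  then have "H (x + 2 * pi) - H x = H (- pi + 2 * pi) - H (- pi)" for x
    using DERIV_isconst_all[of "\<lambda>x. H (x + 2 * pi) - H x" x "- pi"] by simp
  then have H_per: "H (x + 2 * pi) = H x" for x
    by (simp add: H_even)
  obtain g where g: "weak_deriv p g"
    using p_H1 by (auto simp: H1_s_def)
  have p_P_cos: "(\<integral>x. p x * cos (real l * x) \<partial>circle_measure) = (\<integral>x. P x * cos (real l * x) \<partial>circle_measure)" for l
    using integral_p_mult[OF circle_L2_continuous[of "\<lambda>_. 1"], of "\<lambda>x. cos (real l * x)"]
    by (simp add: continuous_intros mult.commute)
  have H_cos: "(\<integral>x. H x * cos (real l * x) \<partial>circle_measure) = (\<integral>x. P x * cos (real l * x) \<partial>circle_measure)"
    if l: "l \<ge> 1" for l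
  proof -
    have "real l * (\<integral>x. H x * cos (real l * x) \<partial>circle_measure)
        = (\<integral>x. H x * (real l * cos (real l * x)) \<partial>circle_measure)"
      by (subst integral_mult_right_zero[symmetric]) (simp only: mult_ac)
    also have "\<dots> = - (\<integral>x. h x * sin (real l * x) \<partial>circle_measure)"
      using H_per[of 0] sin_period[of l 0]
      by (intro circle_integral_by_parts[OF H h])
         (auto intro!: derivative_eq_intros continuous_intros)
    also have "(\<integral>x. h x * sin (real l * x) \<partial>circle_measure)
        = \<kappa> * (\<integral>x. (V' x * sin (real l * x)) * P x \<partial>circle_measure)"
      by (simp add: h_def mult_ac)
    also have "\<dots> = \<kappa> * (\<integral>x. p x * V' x * sin (real l * x) \<partial>circle_measure)"
      by (subst integral_p_mult[OF V'_L2]) (auto intro: continuous_intros)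
    also have "\<dots> = (\<integral>x. g x * sin (real l * x) \<partial>circle_measure)"
      using coeff_equation_iff[OF g V'_L2 weak_deriv_V l c0] eq[OF l] by simp
    also have "\<dots> = - (real l * (\<integral>x. P x * cos (real l * x) \<partial>circle_measure))"
      using weak_deriv_sin_coeff[OF g, of l] by (simp add: p_P_cos)
    finally show ?thesis
      using l by simp
  qed
  \<comment> \<open>The mean value of \<open>P - H\<close>, subtracted to make the coefficient with index 0 vanish as well.\<close>
  define K where "K = (\<integral>x. P x - H x \<partial>circle_measure) / (2 * pi)"
  have "P x - H x - K = 0" for x
  proof (rule even_orthogonal_cos_imp_zero[of "\<lambda>x. P x - H x - K"])
    show "continuous_on UNIV (\<lambda>x. P x - H x - K)"
      by (intro continuous_intros P_continuous H_cont)
    show "(\<integral>x. (P x - H x - K) * cos (real l * x) \<partial>circle_measure) = 0" for l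
    proof -
      have *: "(P x - H x - K) * cos (real l * x) = (P x * cos (real l * x) - H x * cos (real l * x))
          - K * (cos (real l * x) * cos (real 0 * x))" for x
        by (simp add: algebra_simps)
      have i: "integrable circle_measure (\<lambda>x. P x * cos (real l * x))"
        "integrable circle_measure (\<lambda>x. H x * cos (real l * x))"
        "integrable circle_measure (\<lambda>x. cos (real l * x) * cos (real 0 * x))"
        by (intro integrable_circle_continuous continuous_intros P_continuous H_cont)+
      have "(\<integral>x. (P x - H x - K) * cos (real l * x) \<partial>circle_measure)
          = (\<integral>x. P x * cos (real l * x) - H x * cos (real l * x) \<partial>circle_measure)
            - K * (\<integral>x. cos (real l * x) * cos (real 0 * x) \<partial>circle_measure)"
        unfolding * using i by (simp del: of_nat_0)
      also have "\<dots> = 0"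
      proof (cases "l = 0")
        case True
        then show ?thesis
          unfolding circle_integral_cos_cos by (simp add: K_def cos_norm_def)
      next
        case False
        then show ?thesis
          unfolding circle_integral_cos_cos using i H_cos[of l] by simp
      qed
      finally show ?thesis .
    qed
  qed (simp_all only: P_period H_per P_even H_even)
  then have "P = (\<lambda>x. H x + K)"
    by (simp add: fun_eq_iff algebra_simps)
  then show ?thesis
    using DERIV_add[OF H[of x] DERIV_const[of K]] by (simp add: h_def)
qed

text \<open>
  By \<open>P' = \<kappa> V' P\<close> the function \<open>P exp (- \<kappa> V)\<close> is constant; integrating over the circle, where
  \<open>p\<close> has total mass \<open>2\<pi>\<close>, identifies the constant.
\<close>
lemma P_eq_exp:
  assumes c0: "c 0 = 1 / 2" and eq: "\<And>l. l \<ge> 1 \<Longrightarrow> coeff_equation \<kappa> b c l"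
  shows "P x = 1 / (1 / (2 * pi) * (\<integral>y. exp (\<kappa> * V y) \<partial>circle_measure)) * exp (\<kappa> * V x)"
    and "0 < (\<integral>y. exp (\<kappa> * V y) \<partial>circle_measure)"
proof -
  define C where "C = P 0 * exp (- (\<kappa> * V 0))"
  have "((\<lambda>x. P x * exp (- (\<kappa> * V x))) has_real_derivative 0) (at x)" for x
    by (rule derivative_eq_intros P_deriv[OF c0 eq] V_deriv refl | simp)+
  then have "P x * exp (- (\<kappa> * V x)) = C" for x
    unfolding C_def by (intro DERIV_isconst_all) blast
  then have PC: "P x = C * exp (\<kappa> * V x)" for x
    by (metis exp_minus_inverse mult.assoc mult.commute mult.right_neutral)
  have i: "integrable circle_measure (\<lambda>x. exp (\<kappa> * V x))"
    by (intro integrable_circle_continuous continuous_intros V_continuous)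
  have "(\<integral>x. P x \<partial>circle_measure) = (\<integral>x. p x \<partial>circle_measure)"
    using p_eq_P integrable_circle_L2[OF p_L2] integrable_circle_continuous[OF P_continuous]
    by (intro integral_cong_AE) auto
  then have CI: "C * (\<integral>x. exp (\<kappa> * V x) \<partial>circle_measure) = 2 * pi"
    using integral_p[OF c0] i by (simp add: PC)
  have "(\<integral>x. exp (\<kappa> * V x) \<partial>circle_measure) \<ge> 0" by simp
  moreover have "(\<integral>x. exp (\<kappa> * V x) \<partial>circle_measure) \<noteq> 0"
    using CI by auto
  ultimately show pos: "0 < (\<integral>x. exp (\<kappa> * V x) \<partial>circle_measure)"
    by linarith
  have "C = 1 / (1 / (2 * pi) * (\<integral>y. exp (\<kappa> * V y) \<partial>circle_measure))"
    using CI pos by (simp add: field_simps)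
  then show "P x = 1 / (1 / (2 * pi) * (\<integral>y. exp (\<kappa> * V y) \<partial>circle_measure)) * exp (\<kappa> * V x)"
    using PC by simp
qed

lemma stationary_imp_coeff_equation:
  assumes sol: "stationary_MV_solution \<kappa> W p"
  shows "c 0 = 1 / 2" and "l \<ge> 1 \<Longrightarrow> coeff_equation \<kappa> b c l"
proof -
  show c0: "c 0 = 1 / 2"
    using sol p_cos[of 0]
    by (simp add: stationary_MV_solution_def circle_density_def cos_norm_def field_simps)
  obtain g v where v: "v \<in> circle_L2" "weak_deriv V v" and g: "weak_deriv p g"
    and weak: "\<And>\<phi>. \<phi> \<in> circle_test \<Longrightarrow> (\<integral>\<theta>. g \<theta> * deriv \<phi> \<theta> \<partial>circle_measure) =
           \<kappa> * (\<integral>\<theta>. p \<theta> * v \<theta> * deriv \<phi> \<theta> \<partial>circle_measure)"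
    using sol by (auto simp: stationary_MV_solution_def weak_stationary_MV_def circle_conv_eq_V)
  assume l: "l \<ge> 1"
  have d: "deriv (\<lambda>x. cos (real l * x)) = (\<lambda>x. (- real l) * sin (real l * x))"
    using deriv_trig[of 1 l 0] by simp
  have "(\<integral>x. (- real l) * (g x * sin (real l * x)) \<partial>circle_measure)
      = \<kappa> * (\<integral>x. (- real l) * (p x * v x * sin (real l * x)) \<partial>circle_measure)"
    using weak[OF cos_circle_test[of l]] unfolding d by (simp only: mult_ac)
  then have "(\<integral>x. g x * sin (real l * x) \<partial>circle_measure) = \<kappa> * (\<integral>x. p x * v x * sin (real l * x) \<partial>circle_measure)"
    using l by (simp add: mult.left_commute)
  then show "coeff_equation \<kappa> b c l"
    using coeff_equation_iff[OF g v l c0] by simp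
qed

text \<open>
  Nonnegativity of \<open>p\<close> comes from the exponential formula. The witnesses for the
  two weak derivatives are the continuous functions \<open>\<kappa> P V'\<close> and \<open>V'\<close>, for which the tested
  equation holds because the integrands agree almost everywhere.
\<close>
lemma coeff_equation_imp_stationary:
  assumes c0: "c 0 = 1 / 2" and eq: "\<And>l. l \<ge> 1 \<Longrightarrow> coeff_equation \<kappa> b c l"
  shows "stationary_MV_solution \<kappa> W p"
proof -
  define h where "h x = \<kappa> * (P x * V' x)" for x
  have h: "continuous_on UNIV h" "h (x + 2 * pi) = h x" for x
    unfolding h_def by (intro continuous_intros P_continuous V'_continuous) (simp only: P_period V'_period)
  have "weak_deriv P h"
    by (rule weak_deriv_classical[OF P_deriv[OF c0 eq, folded h_def] h(1) P_period])
  then have ph: "weak_deriv p h"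
    by (rule weak_deriv_cong_AE[OF p_eq_P p_L2 P_continuous])
  have "(\<integral>x. h x * deriv \<phi> x \<partial>circle_measure) = \<kappa> * (\<integral>x. p x * V' x * deriv \<phi> x \<partial>circle_measure)"
    if "\<phi> \<in> circle_test" for \<phi>
    using integral_p_mult[OF V'_L2 circle_test_D(2)[OF that]] by (simp add: h_def mult_ac)
  then have "weak_stationary_MV \<kappa> W p"
    unfolding weak_stationary_MV_def circle_conv_eq_V
    using circle_L2_continuous[OF h] V'_L2 ph weak_deriv_V by blast
  moreover have P_nonneg: "P x \<ge> 0" for x
    using P_eq_exp[OF c0 eq] by (simp add: less_imp_le)
  have "AE x in circle_measure. 0 \<le> p x"
    using p_eq_P by eventually_elim (simp add: P_nonneg)
  ultimately show ?thesis
    using p_H1 integral_p[OF c0] by (simp add: stationary_MV_solution_def circle_density_def)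
qed

lemma V_has_sum: "((\<lambda>l. c l * b l * cos (real l * x)) has_sum V x) {1..}"
proof -
  have "summable (\<lambda>l. norm ((b l * c l) * cos (real l * x)))"
    by (rule summable_comparison_test'[OF summable_bc, of 0]) (simp add: abs_mult mult_left_le)
  from norm_summable_imp_has_sum[OF this summable_sums[OF summable_norm_cancel[OF this]]]
  have "((\<lambda>l. (b l * c l) * cos (real l * x)) has_sum V x) UNIV"
    by (simp add: V_def)
  also have "?this \<longleftrightarrow> ?thesis"
    by (rule has_sum_cong_neutral) (auto simp: b_0 not_less_eq_eq mult.commute)
  finally show ?thesis .
qed

end

section \<open>Stationary solutions of the McKean-Vlasov equation\<close>

theorem theorem2p1:
  fixes \<kappa> :: real and W p :: "real \<Rightarrow> real" and a c :: "nat \<Rightarrow> real"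
  assumes kappa_pos: "0 < \<kappa>"
    and W_L2: "W \<in> circle_L2"
    and W_even: "even_fun W"
    and W_series: "L2_sums_from 1 (\<lambda>l \<theta>. a l * cos (real l * \<theta>)) W"
    and p_H1: "p \<in> H1_s"
    and p_series: "L2_sums_from 0 (\<lambda>l \<theta>. 2 * (c l * cos (real l * \<theta>))) p"
  shows "(stationary_MV_solution \<kappa> W p \<longrightarrow>
           c 0 = 1 / 2 \<and>
           (\<forall>l\<ge>1. (coeff_tail a c l) summable_on {l<..} \<and> coeff_equation \<kappa> a c l)) \<and>
         (c 0 = 1 / 2 \<and> (\<forall>l\<ge>1. coeff_equation \<kappa> a c l) \<longrightarrow>
           stationary_MV_solution \<kappa> W p) \<and>
         (stationary_MV_solution \<kappa> W p \<longrightarrow>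
           (\<forall>\<theta>. (\<lambda>l. c l * a l * cos (real l * \<theta>)) summable_on {1..}) \<and>
           (AE \<theta> in circle_measure. p \<theta> = 1 / gibbs_Z \<kappa> a c * gibbs_weight \<kappa> a c \<theta>) \<and>
           (\<forall>\<theta>. isCont p \<theta> \<longrightarrow> p \<theta> = 1 / gibbs_Z \<kappa> a c * gibbs_weight \<kappa> a c \<theta>))"
proof -
  define b where "b = a(0 := 0)"
  have b: "b l = a l" if "l \<ge> 1" for l
    using that by (simp add: b_def)
  interpret mckean_vlasov \<kappa> W p b c
  proof
    have "(\<Sum>l=1..N. a l * cos (real l * x)) = (\<Sum>l=0..N. b l * cos (real l * x))" for N x
      by (rule sum.mono_neutral_cong_left) (auto simp: b_def)
    then show "L2_sums_from 0 (\<lambda>l x. b l * cos (real l * x)) W"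
      using W_series by (simp add: L2_sums_from_def)
    show "L2_sums_from 0 (\<lambda>l x. (2 * c l) * cos (real l * x)) p"
      using p_series by (simp only: mult.assoc)
  qed (use W_L2 W_even p_H1 in \<open>auto simp: b_def\<close>)
  have tail: "coeff_tail a c l j = coeff_tail b c l j" if "j \<in> {l<..}" for l j
    using that by (simp add: coeff_tail_def b)
  have tail_sum: "(\<Sum>\<^sub>\<infinity>j\<in>{l<..}. coeff_tail a c l j) = (\<Sum>\<^sub>\<infinity>j\<in>{l<..}. coeff_tail b c l j)" for l
    by (rule infsum_cong) (rule tail)
  have tail_summable: "coeff_tail a c l summable_on {l<..}" if "l \<ge> 1" for l
  proof -
    have "coeff_tail a c l summable_on {l<..} \<longleftrightarrow> coeff_tail b c l summable_on {l<..}"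
      by (rule summable_on_cong) (rule tail)
    then show ?thesis
      using product_sin_coeff(1)[OF V'_L2 weak_deriv_V that] by simp
  qed
  have coeff: "coeff_equation \<kappa> a c l \<longleftrightarrow> coeff_equation \<kappa> b c l" if "l \<ge> 1" for l
    using that unfolding coeff_equation_def tail_sum by (simp add: b)
  have V_sum: "((\<lambda>l. c l * a l * cos (real l * x)) has_sum V x) {1..}" for x
    using V_has_sum[of x] by (subst has_sum_cong[of _ _ "\<lambda>l. c l * b l * cos (real l * x)"]) (auto simp: b)
  have weight: "gibbs_weight \<kappa> a c = (\<lambda>x. exp (\<kappa> * V x))"
    using infsumI[OF V_sum] by (simp add: gibbs_weight_def fun_eq_iff)
  have gibbs: "P x = 1 / gibbs_Z \<kappa> a c * gibbs_weight \<kappa> a c x"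
    if "stationary_MV_solution \<kappa> W p" for x
    using P_eq_exp(1)[OF stationary_imp_coeff_equation[OF that]] by (simp add: gibbs_Z_def weight)
  have p_eq: "p x = P x" if "isCont p x" for x
  proof -
    have "AE x in circle_measure. p x - P x = 0"
      using p_eq_P by eventually_elim simp
    moreover have "isCont (\<lambda>x. p x - P x) x"
      using that P_continuous by (auto simp: continuous_on_eq_continuous_at intro: continuous_intros)
    ultimately have "p x - P x = 0"
      by (intro AE_zero_isCont_imp_zero[of "\<lambda>x. p x - P x"]) (simp_all only: P_period circle_L2_D(3)[OF p_L2])
    then show ?thesis by simp
  qed
  have "AE x in circle_measure. p x = 1 / gibbs_Z \<kappa> a c * gibbs_weight \<kappa> a c x"
    if "stationary_MV_solution \<kappa> W p"
    using p_eq_P by eventually_elim (simp only: gibbs[OF that])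
  moreover have "(\<lambda>l. c l * a l * cos (real l * \<theta>)) summable_on {1..}" for \<theta>
    using V_sum unfolding summable_on_def by blast
  moreover have "p \<theta> = 1 / gibbs_Z \<kappa> a c * gibbs_weight \<kappa> a c \<theta>"
    if "stationary_MV_solution \<kappa> W p" "isCont p \<theta>" for \<theta>
    using p_eq[OF that(2)] gibbs[OF that(1)] by (rule trans)
  moreover have "c 0 = 1 / 2" "\<forall>l\<ge>1. coeff_equation \<kappa> a c l" if "stationary_MV_solution \<kappa> W p"
    using stationary_imp_coeff_equation[OF that] coeff by blast+
  moreover have "stationary_MV_solution \<kappa> W p" if "c 0 = 1 / 2 \<and> (\<forall>l\<ge>1. coeff_equation \<kappa> a c l)"
    using coeff_equation_imp_stationary coeff that by blast
  ultimately show ?thesis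
    using tail_summable by blast
qed

end
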